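(* Let $\Omega\subset\mathbb{R}^n$ be compact and $p\geq 1$. Let $f:[0,+\infty]\to[0,+\infty]$ be lower semicontinuous and convex with $f(0)=0$ and $\lim_{t\to+\infty}f(t)/t=+\infty$, and let $g:[0,1]\to[0,+\infty]$ be subadditive and lower semicontinuous with $g(0)=0$ and $\lim_{t\to0^+}g(t)/t=+\infty$. Then the minimization problem $$\min\{\mathfrak{F}^p(\mu,\nu)\ :\ \mu,\nu\in\mathcal{P}(\Omega)\}$$ has at least one solution.
   Context: $\mathcal{P}(\Omega)$ denotes the set of Borel probability measures on $\Omega$, with the weak-* topology. For $\mu,\nu\in\mathcal{P}(\Omega)$, $T_p(\mu,\nu)=\inf_\gamma\int_{\Omega\times\Omega}|x-y|^p\,d\gamma(x,y)$, the infimum being over all probability measures $\gamma$ on $\Omega\times\Omega$ with marginals $\mu$ and $\nu$. $F(\mu)=\int_\Omega f(u(x))\,dx$ if $\mu=u\cdot\mathcal{L}^n$ with $u\in L^1(\Omega)$, and $F(\mu)=+\infty$ otherwise. $G(\nu)=\sum_{i}g(a_i)$ if $\nu=\sum_{i=0}^\infty a_i\delta_{x_i}$ is purely atomic (distinct points $x_i$, $a_i\geq 0$), and $G(\nu)=+\infty$ if $\nu$ is not purely atomic. Finally $\mathfrak{F}^p(\mu,\nu)=T_p(\mu,\nu)+F(\mu)+G(\nu)$. *)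

theory Defs
  imports "HOL-Probability.Probability"
begin

definition probs :: "'a::euclidean_space set \<Rightarrow> 'a measure set" where
  "probs \<Omega> = {\<mu>. prob_space \<mu> \<and> sets \<mu> = sets (restrict_space borel \<Omega>)}"

definition couplings :: "'a::euclidean_space set \<Rightarrow> 'a measure \<Rightarrow> 'a measure \<Rightarrow> ('a \<times> 'a) measure set" where
  "couplings \<Omega> \<mu> \<nu> = {\<gamma>. prob_space \<gamma> \<and>
      sets \<gamma> = sets (restrict_space borel \<Omega> \<Otimes>\<^sub>M restrict_space borel \<Omega>) \<and>
      distr \<gamma> (restrict_space borel \<Omega>) fst = \<mu> \<and>
      distr \<gamma> (restrict_space borel \<Omega>) snd = \<nu>}"

definition transport_cost :: "real \<Rightarrow> 'a::euclidean_space set \<Rightarrow> 'a measure \<Rightarrow> 'a measure \<Rightarrow> ennreal" where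
  "transport_cost p \<Omega> \<mu> \<nu> =
     (INF \<gamma>\<in>couplings \<Omega> \<mu> \<nu>. \<integral>\<^sup>+ z. ennreal (norm (fst z - snd z) powr p) \<partial>\<gamma>)"

text \<open>F(\<mu>) = \<integral>_\<Omega> f(u) dx if \<mu> = u \<cdot> Lebesgue on \<Omega>, +\<infinity> otherwise
  (the value does not depend on the a.e. representative u; Inf of the empty set is \<infinity>).\<close>
definition Ffun :: "(ennreal \<Rightarrow> ennreal) \<Rightarrow> 'a::euclidean_space set \<Rightarrow> 'a measure \<Rightarrow> ennreal" where
  "Ffun f \<Omega> \<mu> = Inf {\<integral>\<^sup>+ x. f (u x) \<partial>(restrict_space lborel \<Omega>) | u.
      u \<in> borel_measurable (restrict_space lborel \<Omega>) \<and> \<mu> = density (restrict_space lborel \<Omega>) u}"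

definition purely_atomic :: "'a measure \<Rightarrow> bool" where
  "purely_atomic \<nu> \<longleftrightarrow> (\<exists>A. countable A \<and> A \<subseteq> space \<nu> \<and> A \<in> sets \<nu> \<and> emeasure \<nu> (space \<nu> - A) = 0)"

definition atoms :: "'a measure \<Rightarrow> 'a set" where
  "atoms \<nu> = {x \<in> space \<nu>. {x} \<in> sets \<nu> \<and> measure \<nu> {x} > 0}"

definition Gfun :: "(real \<Rightarrow> ennreal) \<Rightarrow> 'a measure \<Rightarrow> ennreal" where
  "Gfun g \<nu> = (if purely_atomic \<nu>
      then \<integral>\<^sup>+ x. g (measure \<nu> {x}) \<partial>(count_space (atoms \<nu>)) else \<infinity>)"

definition total_energy ::
  "real \<Rightarrow> (ennreal \<Rightarrow> ennreal) \<Rightarrow> (real \<Rightarrow> ennreal) \<Rightarrow> 'a::euclidean_space set \<Rightarrow> 'a measure \<Rightarrow> 'a measure \<Rightarrow> ennreal" where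
  "total_energy p f g \<Omega> \<mu> \<nu> = transport_cost p \<Omega> \<mu> \<nu> + Ffun f \<Omega> \<mu> + Gfun g \<nu>"

definition lsc_ennreal :: "(ennreal \<Rightarrow> ennreal) \<Rightarrow> bool" where
  "lsc_ennreal f \<longleftrightarrow> (\<forall>x. f x \<le> Liminf (at x) f)"

definition lsc_on :: "real set \<Rightarrow> (real \<Rightarrow> ennreal) \<Rightarrow> bool" where
  "lsc_on S g \<longleftrightarrow> (\<forall>x\<in>S. g x \<le> Liminf (at x within S) g)"

definition convex_ennreal :: "(ennreal \<Rightarrow> ennreal) \<Rightarrow> bool" where
  "convex_ennreal f \<longleftrightarrow> (\<forall>x y. \<forall>t::real. 0 \<le> t \<and> t \<le> 1 \<longrightarrow>
      f (ennreal t * x + ennreal (1 - t) * y) \<le> ennreal t * f x + ennreal (1 - t) * f y)"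

definition subadditive_on01 :: "(real \<Rightarrow> ennreal) \<Rightarrow> bool" where
  "subadditive_on01 g \<longleftrightarrow> (\<forall>s t. 0 \<le> s \<and> 0 \<le> t \<and> s + t \<le> 1 \<longrightarrow> g (s + t) \<le> g s + g t)"

end

theory Submission
  imports Defs
begin

text \<open>If the energy is finite, \<open>\<nu>\<close> has atoms \<open>x\<^sub>i\<close> and a coupling splits \<open>\<mu>\<close> into densities \<open>U\<^sub>i\<close>
  transported to \<open>x\<^sub>i\<close>, so one may minimise
  \<open>\<integral> \<Sum>\<^sub>i |y - x\<^sub>i|\<^sup>p U\<^sub>i(y) + f(\<Sum>\<^sub>i U\<^sub>i(y)) dy + \<Sum>\<^sub>i g(\<integral> U\<^sub>i)\<close>
  over points and densities, where subadditivity of \<open>g\<close> allows the \<open>x\<^sub>i\<close> to coincide.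
  Along a minimising sequence with the atoms in order of decreasing mass, points and masses converge
  after a diagonal extraction, and the growth of \<open>g\<close> at \<open>0\<close> keeps the total mass. With points and
  masses under control the rest is convex in \<open>U\<close>, so instead of weak compactness in \<open>L\<^sup>1\<close> one
  passes to averages that converge almost everywhere; the superlinear growth of \<open>f\<close> makes them
  uniformly integrable, and Fatou's lemma gives the lower semicontinuity.\<close>

section \<open>Almost everywhere convergent selections\<close>

text \<open>The positions of the points enter the cost non-convexly and the masses enter
  \<open>g\<close> non-convexly, so averaging must disturb neither. Hence each cost is first
  replaced by the cost at the limit point, with an error uniform in the source variable, and the
  masses are confined to intervals that shrink to the limit masses, a condition stable under
  midpoints. The errors tend to 0 index by index but not uniformly in the index, so only finitely
  many cost terms are carried through the limit, and their number is sent to infinity at the very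
  end. The densities are regarded as one function of index and position, so that a single selection
  treats all indices together. Ordering by decreasing mass bounds the mass of index i by 1/(i+1)
  along the whole sequence, so late indices carry uniformly small atoms, exactly where
  \<open>g\<close> is steep.\<close>

definition half_exp :: "ennreal \<Rightarrow> real" where
  "half_exp v = (if v = \<infinity> then 0 else exp (- enn2real v / 2))"

lemma half_exp_bounds: "0 \<le> half_exp v" "half_exp v \<le> 1"
  by (auto simp: half_exp_def)

lemma antimono_half_exp: "v \<le> w \<Longrightarrow> half_exp w \<le> half_exp v"
  by (auto simp: half_exp_def top_unique less_top intro!: enn2real_mono)

lemma half_exp_midpoint: "(half_exp ((v + w) / 2))\<^sup>2 = half_exp v * half_exp w"
proof (cases "v = \<infinity> \<or> w = \<infinity>")
  case True
  then show ?thesis by (auto simp: half_exp_def ennreal_divide_eq_top_iff ennreal_top_divide)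
next
  case False
  then obtain a b where ab: "v = ennreal a" "w = ennreal b" "0 \<le> a" "0 \<le> b"
    by (metis ennreal_cases infinity_ennreal_def)
  have "(v + w) / 2 = ennreal ((a + b) / 2)"
    using ab by (simp flip: ennreal_plus ennreal_numeral add: divide_ennreal)
  then show ?thesis
    using ab by (simp add: half_exp_def power2_eq_square flip: exp_add add_divide_distrib) (simp add: field_simps)
qed

lemma borel_measurable_half_exp [measurable]: "half_exp \<in> borel_measurable borel"
  unfolding half_exp_def[abs_def] by measurable

lemma tendsto_half_expD:
  fixes X :: "nat \<Rightarrow> ennreal"
  assumes lim: "(\<lambda>k. half_exp (X k)) \<longlonglongrightarrow> r"
  shows "convergent X"
proof (cases "r > 0")
  case True
  have ev: "\<forall>\<^sub>F k in sequentially. half_exp (X k) > 0"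
    using order_tendstoD(1)[OF lim True] .
  have "(\<lambda>k. ennreal (- 2 * ln (half_exp (X k)))) \<longlonglongrightarrow> ennreal (- 2 * ln r)"
    using True by (intro tendsto_ennrealI tendsto_intros lim) auto
  moreover have "\<forall>\<^sub>F k in sequentially. ennreal (- 2 * ln (half_exp (X k))) = X k"
    using ev by eventually_elim (auto simp: half_exp_def less_top split: if_splits)
  ultimately have "X \<longlonglongrightarrow> ennreal (- 2 * ln r)"
    using tendsto_cong by force
  then show ?thesis by (auto simp: convergent_def)
next
  case False
  moreover have "r \<ge> 0"
    using lim by (rule LIMSEQ_le_const) (auto simp: half_exp_bounds)
  ultimately have lim0: "(\<lambda>k. half_exp (X k)) \<longlonglongrightarrow> 0" using lim by simp
  have "X \<longlonglongrightarrow> top"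
  proof (rule order_tendstoI)
    fix b :: ennreal assume "b < top"
    then have "half_exp b > 0" by (auto simp: half_exp_def)
    from order_tendstoD(2)[OF lim0 this]
    show "\<forall>\<^sub>F k in sequentially. b < X k"
      by eventually_elim (meson antimono_half_exp leD not_le)
  qed auto
  then show ?thesis by (auto simp: convergent_def)
qed

text \<open>Weighted by 2^n, the squared increments still have summable integrals, namely at most
  2^-n. Pointwise, an increment larger than 2^-n is at most 2^n times its square, so a finite
  weighted sum forces absolute summability.\<close>

lemma AE_convergent_of_summable_L2_increments:
  fixes w :: "nat \<Rightarrow> 'a \<Rightarrow> real"
  assumes [measurable]: "\<And>n. w n \<in> borel_measurable M"
    and bd: "\<And>n. (\<integral>\<^sup>+x. ennreal ((w (Suc n) x - w n x)\<^sup>2) \<partial>M) \<le> ennreal ((1/4) ^ n)"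
  shows "AE x in M. convergent (\<lambda>n. w n x)"
proof -
  have "(\<integral>\<^sup>+x. (\<Sum>n. ennreal (2 ^ n * (w (Suc n) x - w n x)\<^sup>2)) \<partial>M)
      = (\<Sum>n. \<integral>\<^sup>+x. ennreal (2 ^ n * (w (Suc n) x - w n x)\<^sup>2) \<partial>M)"
    by (subst nn_integral_suminf) auto
  also have "\<dots> \<le> (\<Sum>n. ennreal ((1/2) ^ n))"
  proof (intro suminf_le allI)
    fix n
    have "(\<integral>\<^sup>+x. ennreal (2 ^ n * (w (Suc n) x - w n x)\<^sup>2) \<partial>M)
       = ennreal (2 ^ n) * (\<integral>\<^sup>+x. ennreal ((w (Suc n) x - w n x)\<^sup>2) \<partial>M)"
      by (subst ennreal_mult', simp, subst nn_integral_cmult) auto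
    also have "\<dots> \<le> ennreal (2 ^ n) * ennreal ((1/4) ^ n)"
      by (intro mult_left_mono bd) auto
    also have "\<dots> = ennreal ((1/2) ^ n)"
      by (simp flip: ennreal_mult' power_mult_distrib)
    finally show "(\<integral>\<^sup>+x. ennreal (2 ^ n * (w (Suc n) x - w n x)\<^sup>2) \<partial>M) \<le> ennreal ((1/2) ^ n)" .
  qed auto
  also have "\<dots> < \<infinity>"
    by (subst suminf_ennreal2) (auto intro!: summable_geometric)
  finally have "AE x in M. (\<Sum>n. ennreal (2 ^ n * (w (Suc n) x - w n x)\<^sup>2)) \<noteq> \<infinity>"
    by (intro nn_integral_PInf_AE) auto
  then show ?thesis
  proof eventually_elim
    case (elim x)
    let ?d = "\<lambda>n. w (Suc n) x - w n x"
    have s1: "summable (\<lambda>n. 2 ^ n * (?d n)\<^sup>2)"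
      using elim by (intro summable_suminf_not_top) auto
    have "summable (\<lambda>n. (1/2::real) ^ n)" by (intro summable_geometric) auto
    then have s2: "summable (\<lambda>n. (1/2) ^ n + 2 ^ n * (?d n)\<^sup>2)"
      using s1 by (intro summable_add)
    have "norm (?d n) \<le> (1/2) ^ n + 2 ^ n * (?d n)\<^sup>2" for n
    proof (cases "2 ^ n * \<bar>?d n\<bar> \<le> 1")
      case True
      then have "\<bar>?d n\<bar> \<le> (1/2) ^ n" by (simp add: field_simps power_divide)
      then show ?thesis by (simp add: add_increasing2)
    next
      case False
      then have "\<bar>?d n\<bar> * 1 \<le> \<bar>?d n\<bar> * (2 ^ n * \<bar>?d n\<bar>)"
        by (intro mult_left_mono) auto
      also have "\<dots> = 2 ^ n * (?d n)\<^sup>2" by (simp add: power2_eq_square)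
      finally show ?thesis by (simp add: add_increasing)
    qed
    then have "summable ?d" by (rule summable_comparison_test'[OF s2])
    then have "convergent (\<lambda>n. \<Sum>k<n. ?d k)" by (simp add: summable_iff_convergent)
    moreover have "(\<Sum>k<n. ?d k) = w n x - w 0 x" for n
      by (rule sum_lessThan_telescope)
    ultimately have "convergent (\<lambda>n. w n x - w 0 x)" by simp
    from convergent_add[OF this convergent_const[of "w 0 x"]] show ?case by simp
  qed
qed

text \<open>Minimising \<open>\<integral> exp (- v)\<close> over each \<open>C k\<close> works because the midpoint
  defect of \<open>exp (- v)\<close> is the square of the difference of \<open>exp (- v / 2)\<close>, so almost minimisers are
  Cauchy in \<open>L\<^sup>2\<close> after this change of variable.\<close>
lemma midpoint_convex_AE_convergent_selection:
  fixes C :: "nat \<Rightarrow> ('a \<Rightarrow> ennreal) set"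
  assumes M: "finite_measure M"
    and dec: "decseq C" and ne: "\<And>k. C k \<noteq> {}"
    and meas: "\<And>k v. v \<in> C k \<Longrightarrow> v \<in> borel_measurable M"
    and mid: "\<And>k v w. v \<in> C k \<Longrightarrow> w \<in> C k \<Longrightarrow> (\<lambda>x. (v x + w x) / 2) \<in> C k"
  obtains v where "\<And>k. v k \<in> C k" "AE x in M. convergent (\<lambda>k. v k x)"
proof -
  interpret finite_measure M by fact
  define \<Phi> where "\<Phi> v = (\<integral>x. (half_exp (v x))\<^sup>2 \<partial>M)" for v
  have int: "integrable M (\<lambda>x. half_exp (v x) * half_exp (w x))"
    if "v \<in> borel_measurable M" "w \<in> borel_measurable M" for v w
    using that half_exp_bounds
    by (intro integrable_const_bound[where B=1]) (auto simp: abs_mult mult_le_one)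
  have \<Phi>_nonneg: "0 \<le> \<Phi> v" for v by (auto simp: \<Phi>_def)
  define I where "I k = (INF v\<in>C k. \<Phi> v)" for k
  have bdd: "bdd_below (\<Phi> ` C k)" for k by (auto intro!: bdd_belowI[of _ 0] \<Phi>_nonneg)
  have I_le: "I k \<le> \<Phi> v" if "v \<in> C k" for k v
    unfolding I_def by (rule cINF_lower[OF bdd that])
  have incI: "incseq I"
    unfolding I_def using dec ne bdd
    by (intro incseq_SucI cINF_superset_mono) (auto simp: decseq_Suc_iff)
  have \<Phi>_le: "\<Phi> v \<le> measure M (space M)" if "v \<in> borel_measurable M" for v
  proof -
    have "\<Phi> v \<le> (\<integral>x. 1 \<partial>M)" unfolding \<Phi>_def
      using int[OF that that] half_exp_bounds by (intro integral_mono) (auto simp: power2_eq_square mult_le_one)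
    then show ?thesis by simp
  qed
  have Ibd: "I k \<le> measure M (space M)" for k
    using ne[of k] I_le \<Phi>_le meas by (meson ex_in_conv order_trans)
  obtain J where J: "I \<longlonglongrightarrow> J" "\<And>k. I k \<le> J"
    using incseq_convergent[OF incI] Ibd by blast
  have "\<exists>v\<in>C k. \<Phi> v < I k + 1 / Suc k" for k
  proof -
    have "(INF v\<in>C k. \<Phi> v) < I k + 1 / Suc k" by (simp add: I_def)
    then show ?thesis using cINF_less_iff[OF ne bdd] by blast
  qed
  then obtain v where v: "\<And>k. v k \<in> C k" "\<And>k. \<Phi> (v k) < I k + 1 / Suc k" by metis
  have vm [measurable]: "v k \<in> borel_measurable M" for k using v(1) meas by blast
  \<comment> \<open>For j \<ge> k, \<open>\<Phi> (v j)\<close> is at most \<open>J\<close> +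
    1/(k+1), \<open>\<Phi> (v k)\<close> is at most \<open>I k\<close> + 1/(k+1), and the midpoint,
    which lies in \<open>C k\<close>, contributes -2 \<open>I k\<close>.\<close>
  define \<delta> where "\<delta> k = J - I k + 2 / Suc k" for k
  have cauchy: "(\<integral>x. (half_exp (v j x) - half_exp (v k x))\<^sup>2 \<partial>M) \<le> \<delta> k" if "k \<le> j" for j k
  proof -
    have "v j \<in> C k" using decseqD[OF dec that] v(1) by blast
    from mid[OF this v(1)[of k]] have "I k \<le> \<Phi> (\<lambda>x. (v j x + v k x) / 2)" by (rule I_le)
    then have *: "I k \<le> (\<integral>x. half_exp (v j x) * half_exp (v k x) \<partial>M)"
      by (simp add: \<Phi>_def half_exp_midpoint)
    have "(\<integral>x. (half_exp (v j x) - half_exp (v k x))\<^sup>2 \<partial>M)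
      = (\<integral>x. half_exp (v j x) * half_exp (v j x) + half_exp (v k x) * half_exp (v k x)
            - 2 * (half_exp (v j x) * half_exp (v k x)) \<partial>M)"
      by (intro Bochner_Integration.integral_cong) (auto simp: power2_eq_square algebra_simps)
    also have "\<dots> = \<Phi> (v j) + \<Phi> (v k) - 2 * (\<integral>x. half_exp (v j x) * half_exp (v k x) \<partial>M)"
      by (simp add: \<Phi>_def int power2_eq_square)
    also have "\<dots> \<le> \<delta> k"
    proof -
      have "1 / real (Suc j) \<le> 1 / Suc k" using that by (intro divide_left_mono) auto
      moreover have "2 / real (Suc k) = 1 / Suc k + 1 / Suc k" by simp
      ultimately show ?thesis
        unfolding \<delta>_def using v(2)[of j] v(2)[of k] * J(2)[of j] by linarith
    qed
    finally show ?thesis .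
  qed
  have "(\<lambda>k. J - I k + 2 * (1 / real (Suc k))) \<longlonglongrightarrow> J - J + 2 * 0"
    by (intro tendsto_intros J(1) lim_1_over_n LIMSEQ_Suc)
  then have "\<delta> \<longlonglongrightarrow> 0" unfolding \<delta>_def[abs_def] by simp
  then have "\<forall>n. \<exists>N. \<forall>k\<ge>N. \<delta> k < (1/4) ^ n"
    by (auto dest!: order_tendstoD(2)[where a="(1/4) ^ _"] simp: eventually_sequentially)
  then obtain N where N: "\<And>n k. k \<ge> N n \<Longrightarrow> \<delta> k < (1/4) ^ n" by metis
  \<comment> \<open>Summing the \<open>N i\<close> makes \<open>r\<close> monotone and at least
    \<open>N n\<close>; the summand n gives \<open>r n\<close> \<ge> n, so that
    \<open>v (r n)\<close> lies in \<open>C n\<close>.\<close>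
  define r where "r n = n + (\<Sum>i\<le>n. N i)" for n
  have rN: "r n \<ge> N n" "r n \<ge> n" "r n \<le> r (Suc n)" for n
    by (auto simp: r_def intro!: trans_le_add2 member_le_sum)
  have "AE x in M. convergent (\<lambda>n. half_exp (v (r n) x))"
  proof (rule AE_convergent_of_summable_L2_increments)
    fix n
    have "integrable M (\<lambda>x. (half_exp (v (r (Suc n)) x) - half_exp (v (r n) x))\<^sup>2)"
      by (simp add: power2_eq_square algebra_simps int)
    then show "(\<integral>\<^sup>+x. ennreal ((half_exp (v (r (Suc n)) x) - half_exp (v (r n) x))\<^sup>2) \<partial>M)
       \<le> ennreal ((1/4) ^ n)"
      using cauchy[OF rN(3), of n] N[OF rN(1), of n]
      by (subst nn_integral_eq_integral) (auto intro!: ennreal_leI)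
  qed simp
  then have "AE x in M. convergent (\<lambda>n. v (r n) x)"
    by eventually_elim (metis convergentD tendsto_half_expD)
  moreover have "v (r k) \<in> C k" for k
    using decseqD[OF dec rN(2)[of k]] v(1) by blast
  ultimately show thesis using that[of "\<lambda>k. v (r k)"] by blast
qed

section \<open>The integrands\<close>

lemma lsc_on_sequentially:
  assumes "lsc_on S g" "x \<in> S" "\<And>k. X k \<in> S" "X \<longlonglongrightarrow> x"
  shows "g x \<le> liminf (\<lambda>k. g (X k))"
proof (unfold le_Liminf_iff, intro allI impI)
  fix y assume y: "y < g x"
  have "g x \<le> Liminf (at x within S) g" using assms by (auto simp: lsc_on_def)
  then have "\<forall>\<^sub>F z in at x within S. y < g z" using y by (auto simp: le_Liminf_iff)
  \<comment> \<open>The filter \<open>at x within S\<close> omits x, but \<open>X\<close> may hit x;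
    there \<open>y < g x\<close> takes over.\<close>
  then have "\<forall>\<^sub>F z in nhds x. z \<in> S \<longrightarrow> y < g z"
    unfolding eventually_at_filter by eventually_elim (use y in auto)
  then show "\<forall>\<^sub>F k in sequentially. y < g (X k)"
    by (rule eventually_compose_filterlim[OF _ assms(4), THEN eventually_mono]) (simp add: assms(3))
qed

text \<open>Induction only reaches finite sums; lower semicontinuity along the partial sums, which
  converge to the full sum, carries the bound to the series.\<close>

lemma subadditive_on01_suminf:
  assumes sub: "subadditive_on01 g" and lsc: "lsc_on {0..1} g" and g0: "g 0 = 0"
    and b: "\<And>i. 0 \<le> b i" "summable b" "suminf b \<le> 1"
  shows "g (suminf b) \<le> (\<Sum>i. g (b i))"
proof -
  have le1: "(\<Sum>i<n. b i) \<le> 1" for n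
    using sum_le_suminf[OF b(2), of "{..<n}"] b by simp
  have fin: "g (\<Sum>i<n. b i) \<le> (\<Sum>i<n. g (b i))" for n
  proof (induction n)
    case (Suc n)
    have "g ((\<Sum>i<n. b i) + b n) \<le> g (\<Sum>i<n. b i) + g (b n)"
      using sub le1[of "Suc n"] b(1) by (auto simp: subadditive_on01_def sum_nonneg)
    also have "\<dots> \<le> (\<Sum>i<n. g (b i)) + g (b n)" using Suc by (intro add_right_mono)
    finally show ?case by simp
  qed (simp add: g0)
  have "g (suminf b) \<le> liminf (\<lambda>n. g (\<Sum>i<n. b i))"
    using b le1 by (intro lsc_on_sequentially[OF lsc])
      (auto intro!: sum_nonneg suminf_nonneg summable_LIMSEQ)
  also have "\<dots> \<le> limsup (\<lambda>n. g (\<Sum>i<n. b i))" by (intro Liminf_le_Limsup) auto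
  also have "\<dots> \<le> (\<Sum>i. g (b i))"
    by (intro Limsup_bounded always_eventually allI order_trans[OF fin] sum_le_suminf) auto
  finally show ?thesis .
qed

lemma superlinear_at_0D:
  fixes M :: real
  assumes "((\<lambda>t. g t / ennreal t) \<longlongrightarrow> \<infinity>) (at_right 0)"
  obtains \<delta> :: real where "0 < \<delta>" "\<And>t. 0 < t \<Longrightarrow> t < \<delta> \<Longrightarrow> ennreal M * ennreal t \<le> g t"
proof -
  have "\<forall>\<^sub>F t in at_right 0. ennreal M < g t / ennreal t"
    using assms by (rule order_tendstoD) simp
  then obtain \<delta> :: real where \<delta>: "0 < \<delta>" "\<And>t. 0 < t \<Longrightarrow> t < \<delta> \<Longrightarrow> ennreal M < g t / ennreal t"
    by (auto simp: eventually_at_right_field)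
  have "ennreal M * ennreal t \<le> g t" if "0 < t" "t < \<delta>" for t
  proof -
    have "ennreal M * ennreal t \<le> g t / ennreal t * ennreal t"
      using \<delta>(2)[OF that] by (intro mult_right_mono) auto
    also have "\<dots> = g t" using that by (simp add: ennreal_divide_times)
    finally show ?thesis .
  qed
  with \<delta>(1) show thesis using that by blast
qed

text \<open>Convexity and lower semicontinuity do not force a superlinear \<open>f\<close> to be infinite at \<open>\<infinity>\<close>;
  densities are finite almost everywhere, so this value may be corrected.\<close>
definition fix_top :: "(ennreal \<Rightarrow> ennreal) \<Rightarrow> ennreal \<Rightarrow> ennreal" where
  "fix_top f t = (if t = \<infinity> then \<infinity> else f t)"

lemma fix_top_ge: "f t \<le> fix_top f t"
  by (simp add: fix_top_def)

text \<open>On the segment from 0 to a finite t, convexity and \<open>f 0 = 0\<close> give f(s)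
  \<le> (s/t) f(t) \<le> f(t). At \<infinity> the corrected value is the largest one.\<close>

lemma mono_fix_top:
  assumes cvx: "convex_ennreal f" and f0: "f 0 = 0"
  shows "mono (fix_top f)"
proof
  fix s t :: ennreal assume st: "s \<le> t"
  show "fix_top f s \<le> fix_top f t"
  proof (cases "t = \<infinity> \<or> t = 0")
    case True
    then show ?thesis using st by (auto simp: fix_top_def)
  next
    case False
    then obtain a where a: "t = ennreal a" "0 < a"
      by (cases t) (auto simp: less_le)
    with st obtain b where b: "s = ennreal b" "0 \<le> b" "b \<le> a"
      by (cases s) (auto simp: top_unique)
    have "ennreal (b / a) * t + ennreal (1 - b / a) * 0 = s"
      using a b by (simp flip: ennreal_mult')
    then have "f s \<le> ennreal (b / a) * f t + ennreal (1 - b / a) * f 0"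
      using cvx[unfolded convex_ennreal_def, rule_format, of "b / a" t 0] a b by simp
    also have "\<dots> \<le> 1 * f t"
    proof -
      have "ennreal (b / a) \<le> 1" using a b by simp
      from mult_right_mono[OF this, of "f t"] show ?thesis by (simp add: f0)
    qed
    finally show ?thesis using a b by (simp add: fix_top_def)
  qed
qed

lemma fix_top_midpoint:
  assumes "convex_ennreal f"
  shows "fix_top f ((x + y) / 2) \<le> (fix_top f x + fix_top f y) / 2"
proof (cases "x = \<infinity> \<or> y = \<infinity>")
  case True
  then show ?thesis by (auto simp: fix_top_def ennreal_top_divide)
next
  case False
  have "inverse 2 = ennreal (1/2)" using inverse_ennreal[of 2] by simp
  then have half: "z / 2 = ennreal (1/2) * z" for z :: ennreal
    by (simp add: divide_ennreal_def mult.commute)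
  have "f (ennreal (1/2) * x + ennreal (1 - 1/2) * y) \<le> ennreal (1/2) * f x + ennreal (1 - 1/2) * f y"
    using assms[unfolded convex_ennreal_def, rule_format, of "1/2" x y] by simp
  with False show ?thesis
    unfolding half by (auto simp: fix_top_def distrib_left ennreal_mult_eq_top_iff)
qed

lemma fix_top_superlinear:
  assumes "((\<lambda>t::real. f (ennreal t) / ennreal t) \<longlongrightarrow> \<infinity>) at_top"
  obtains R :: real where "0 < R" "\<And>t. ennreal R \<le> t \<Longrightarrow> ennreal M * t \<le> fix_top f t"
proof -
  have "\<forall>\<^sub>F t in at_top. ennreal M < f (ennreal t) / ennreal t"
    using assms by (rule order_tendstoD) simp
  then obtain R0 where R0: "\<And>t. R0 \<le> t \<Longrightarrow> ennreal M < f (ennreal t) / ennreal t"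
    by (auto simp: eventually_at_top_linorder)
  define R where "R = max R0 1"
  have "ennreal M * t \<le> fix_top f t" if "ennreal R \<le> t" for t
  proof (cases t)
    case (real a)
    then have a: "R \<le> a" "0 < a" "R0 \<le> a" using that by (auto simp: R_def)
    have "ennreal M * ennreal a \<le> f (ennreal a) / ennreal a * ennreal a"
      using R0[OF a(3)] by (intro mult_right_mono) auto
    also have "\<dots> = f (ennreal a)" using a by (simp add: ennreal_divide_times)
    finally show ?thesis using real by (simp add: fix_top_def)
  qed (simp add: fix_top_def)
  then show thesis using that[of R] by (auto simp: R_def)
qed

text \<open>Any y below the value at x is already below the value at some s < x: by lower
  semicontinuity from the left for finite x, by superlinear growth for x = \<infinity>. Monotonicity
  then covers all indices with \<open>s < X k\<close>. Asking only for a bound on the lower limit,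
  not for convergence, fits infinite sums of densities, for which Fatou's lemma yields no
  more.\<close>

lemma fix_top_le_liminf:
  fixes X :: "nat \<Rightarrow> ennreal"
  assumes cvx: "convex_ennreal f" and f0: "f 0 = 0" and lsc: "lsc_ennreal f"
    and sup: "((\<lambda>t::real. f (ennreal t) / ennreal t) \<longlongrightarrow> \<infinity>) at_top"
    and x: "x \<le> liminf X"
  shows "fix_top f x \<le> liminf (\<lambda>k. fix_top f (X k))"
proof (unfold le_Liminf_iff, intro allI impI)
  fix y assume y: "y < fix_top f x"
  have "\<exists>s<x. y < fix_top f s"
  proof (cases "x = \<infinity>")
    case True
    obtain R where R: "0 < R" "\<And>t. ennreal R \<le> t \<Longrightarrow> ennreal 1 * t \<le> fix_top f t"
      using fix_top_superlinear[OF sup, of 1] by blast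
    have "y < \<infinity>" using y True by (simp add: fix_top_def)
    then obtain b where b: "y = ennreal b" "0 \<le> b" by (cases y) auto
    have "ennreal 1 * ennreal (R + b) \<le> fix_top f (ennreal (R + b))"
      using R(1) b by (intro R(2) ennreal_leI) auto
    moreover have "y < ennreal (R + b)" using R(1) b by (simp add: ennreal_lessI)
    ultimately have "y < fix_top f (ennreal (R + b))" by simp
    with True show ?thesis by (intro exI[of _ "ennreal (R + b)"]) auto
  next
    case False
    then have yf: "y < f x" using y by (simp add: fix_top_def)
    then have x0: "0 < x" using f0 by (cases "x = 0") (auto simp: zero_less_iff_neq_zero)
    have "\<forall>\<^sub>F z in at x. y < f z"
      using lsc yf unfolding lsc_ennreal_def le_Liminf_iff by blast
    then have "\<forall>\<^sub>F z in at_left x. y < f z" by (simp add: eventually_at_split)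
    then obtain b where b: "b < x" "\<And>z. b < z \<Longrightarrow> z < x \<Longrightarrow> y < f z"
      unfolding eventually_at_left[OF x0] by blast
    obtain z where "b < z" "z < x" using dense[OF b(1)] by blast
    with b(2) show ?thesis by (intro exI[of _ z]) (auto simp: fix_top_def)
  qed
  then obtain s where s: "s < x" "y < fix_top f s" by blast
  have "\<forall>\<^sub>F k in sequentially. s < X k" using x s(1) by (auto simp: le_Liminf_iff)
  then show "\<forall>\<^sub>F k in sequentially. y < fix_top f (X k)"
    by eventually_elim
      (rule less_le_trans[OF s(2)], rule monoD[OF mono_fix_top[OF cvx f0]], rule less_imp_le)
qed

text \<open>Superlevel sets are upward closed, hence closed or open rays starting at their
  infimum.\<close>

lemma borel_measurable_mono_ennreal:
  fixes F :: "ennreal \<Rightarrow> ennreal"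
  assumes "mono F"
  shows "F \<in> borel_measurable borel"
proof (rule borel_measurableI_greater)
  fix y
  define S where "S = {t. y < F t}"
  define i where "i = Inf S"
  have up: "t \<in> S" if "s \<in> S" "s \<le> t" for s t
    using that monoD[OF assms that(2)] by (auto simp: S_def)
  have low: "i \<le> t" if "t \<in> S" for t
    unfolding i_def using that by (rule Inf_lower)
  have gt: "t \<in> S" if "i < t" for t
  proof -
    obtain s where "s \<in> S" "s < t" using \<open>i < t\<close> unfolding i_def Inf_less_iff by blast
    then show ?thesis using up by (meson less_imp_le)
  qed
  have "S = {i..} \<or> S = {i<..}"
  proof (cases "i \<in> S")
    case True
    then have "S = {i..}" using up low by auto
    then show ?thesis ..
  next
    case False
    then have "S = {i<..}" using gt low by (auto simp: less_le)
    then show ?thesis ..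
  qed
  then have "S \<in> sets borel" by auto
  then show "{x \<in> space borel. y < F x} \<in> sets borel" by (simp add: S_def)
qed

section \<open>Reduction to points and densities\<close>

abbreviation lebesgue_within :: "'a::euclidean_space set \<Rightarrow> 'a measure" where
  "lebesgue_within \<Omega> \<equiv> restrict_space lborel \<Omega>"

text \<open>\<open>U i\<close> is the density of the part of the source that is sent to
  \<open>x i\<close>. Distinctness of the points is not imposed, because it is lost when points
  merge in a limit.\<close>

definition admissible :: "'a::euclidean_space set \<Rightarrow> (nat \<Rightarrow> 'a) \<Rightarrow> (nat \<Rightarrow> 'a \<Rightarrow> ennreal) \<Rightarrow> bool" where
  "admissible \<Omega> x U \<longleftrightarrow> range x \<subseteq> \<Omega> \<and> (\<forall>i. U i \<in> borel_measurable (lebesgue_within \<Omega>)) \<and>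
     (\<Sum>i. \<integral>\<^sup>+y. U i y \<partial>lebesgue_within \<Omega>) = 1"

text \<open>Cost and integrand are parameters: lower semicontinuity is proved for any continuous
  nonnegative \<open>c\<close>, and \<open>F\<close> will be \<open>fix_top f\<close>. For
  admissible data each mass is at most 1, so \<open>enn2real\<close> loses nothing.\<close>

definition reduced_energy :: "('a \<Rightarrow> 'a \<Rightarrow> real) \<Rightarrow> (ennreal \<Rightarrow> ennreal) \<Rightarrow> (real \<Rightarrow> ennreal)
    \<Rightarrow> 'a::euclidean_space set \<Rightarrow> (nat \<Rightarrow> 'a) \<Rightarrow> (nat \<Rightarrow> 'a \<Rightarrow> ennreal) \<Rightarrow> ennreal" where
  "reduced_energy c F g \<Omega> x U =
     (\<integral>\<^sup>+y. (\<Sum>i. ennreal (c y (x i)) * U i y) + F (\<Sum>i. U i y) \<partial>lebesgue_within \<Omega>)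
     + (\<Sum>i. g (enn2real (\<integral>\<^sup>+y. U i y \<partial>lebesgue_within \<Omega>)))"

lemma finite_measure_lebesgue_within:
  assumes "compact \<Omega>"
  shows "finite_measure (lebesgue_within \<Omega>)"
  using emeasure_compact_finite[OF assms] assms
  by (intro finite_measureI) (auto simp: emeasure_restrict_space space_restrict_space borel_compact)

lemma sets_lebesgue_within [measurable_cong]:
  "sets (lebesgue_within \<Omega>) = sets (restrict_space borel \<Omega>)"
  by (intro sets_restrict_space_cong) simp

lemma space_lebesgue_within [simp]: "space (lebesgue_within \<Omega>) = \<Omega>"
  by (simp add: space_restrict_space)

lemma countable_in_sets_restrict_borel:
  fixes B :: "'a::t1_space set"
  assumes "countable B" "B \<subseteq> \<Omega>"
  shows "B \<in> sets (restrict_space borel \<Omega>)"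
proof -
  have "B \<in> sets borel" using assms(1) by (rule sets.countable[rotated]) simp
  moreover have "B = \<Omega> \<inter> B" using assms(2) by auto
  ultimately show ?thesis unfolding sets_restrict_space by (rule rev_image_eqI)
qed

text \<open>Several indices may feed one atom. Countable subadditivity applies at each atom, and
  after exchanging sum and integral each index is counted for at most one atom.\<close>

lemma Gfun_le_of_decomposition:
  fixes x :: "nat \<Rightarrow> 'a"
  assumes sub: "subadditive_on01 g" and lsc: "lsc_on {0..1} g" and g0: "g 0 = 0"
    and a: "\<And>i. 0 \<le> a i" "summable a" "suminf a \<le> 1"
    and atomic: "purely_atomic \<nu>"
    and \<nu>: "\<And>z. z \<in> atoms \<nu> \<Longrightarrow> measure \<nu> {z} = (\<Sum>i. a i * indicator {z} (x i))"
  shows "Gfun g \<nu> \<le> (\<Sum>i. g (a i))"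
proof -
  have "g (measure \<nu> {z}) \<le> (\<Sum>i. indicator {z} (x i) * g (a i))" if "z \<in> atoms \<nu>" for z
  proof -
    have s: "summable (\<lambda>i. a i * indicator {z} (x i))"
      using a by (intro summable_comparison_test'[OF a(2)]) (auto simp: indicator_def)
    have "(\<Sum>i. a i * indicator {z} (x i)) \<le> suminf a"
      using a s by (intro suminf_le) (auto simp: indicator_def)
    then have "g (\<Sum>i. a i * indicator {z} (x i)) \<le> (\<Sum>i. g (a i * indicator {z} (x i)))"
      using a s by (intro subadditive_on01_suminf[OF sub lsc g0]) auto
    also have "\<dots> = (\<Sum>i. indicator {z} (x i) * g (a i))"
      by (intro suminf_cong) (auto simp: indicator_def g0)
    finally show ?thesis using \<nu>[OF that] by simp
  qed
  then have "Gfun g \<nu> \<le> (\<integral>\<^sup>+z. (\<Sum>i. indicator {z} (x i) * g (a i)) \<partial>count_space (atoms \<nu>))"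
    using atomic by (auto simp: Gfun_def intro!: nn_integral_mono)
  also have "\<dots> = (\<Sum>i. \<integral>\<^sup>+z. indicator {z} (x i) * g (a i) \<partial>count_space (atoms \<nu>))"
    by (intro nn_integral_suminf) auto
  also have "\<dots> \<le> (\<Sum>i. g (a i))"
  proof (intro suminf_le allI)
    fix i
    have "(\<integral>\<^sup>+z. indicator {z} (x i) * g (a i) \<partial>count_space (atoms \<nu>))
       = (\<integral>\<^sup>+z. g (a i) * indicator {x i} z \<partial>count_space (atoms \<nu>))"
      by (intro nn_integral_cong) (auto simp: indicator_def)
    also have "\<dots> = (\<integral>\<^sup>+z. g (a i) * indicator {x i} z * indicator (atoms \<nu>) z \<partial>count_space UNIV)"
      by (simp add: nn_integral_count_space_indicator)
    also have "\<dots> \<le> (\<integral>\<^sup>+z. g (a i) * indicator {x i} z \<partial>count_space UNIV)"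
      by (intro nn_integral_mono) (auto split: split_indicator)
    also have "\<dots> = g (a i)" by (simp add: nn_integral_cmult_indicator)
    finally show "(\<integral>\<^sup>+z. indicator {z} (x i) * g (a i) \<partial>count_space (atoms \<nu>)) \<le> g (a i)" .
  qed auto
  finally show ?thesis .
qed

section \<open>Measures built from points and densities\<close>

lemma ennreal_enn2real_admissible:
  assumes "admissible \<Omega> x U"
  shows "ennreal (enn2real (\<integral>\<^sup>+y. U i y \<partial>lebesgue_within \<Omega>)) = (\<integral>\<^sup>+y. U i y \<partial>lebesgue_within \<Omega>)"
proof -
  have "(\<integral>\<^sup>+y. U i y \<partial>lebesgue_within \<Omega>) \<le> (\<Sum>i. \<integral>\<^sup>+y. U i y \<partial>lebesgue_within \<Omega>)"
    using sum_le_suminf[of "\<lambda>i. \<integral>\<^sup>+y. U i y \<partial>lebesgue_within \<Omega>" "{i}"] by simp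
  also have "\<dots> = 1" using assms by (simp add: admissible_def)
  finally show ?thesis by (intro ennreal_enn2real) (auto intro: le_less_trans)
qed

lemma borel_measurable_power_cost:
  fixes \<Omega> :: "'a::euclidean_space set"
  shows "(\<lambda>z. ennreal (norm (fst z - snd z) powr p))
    \<in> borel_measurable (restrict_space borel \<Omega> \<Otimes>\<^sub>M restrict_space borel \<Omega>)"
proof -
  let ?R = "restrict_space borel \<Omega>"
  have id: "(\<lambda>y. y) \<in> borel_measurable ?R" by (rule measurable_restrict_space1) simp
  have [measurable]: "fst \<in> borel_measurable (?R \<Otimes>\<^sub>M ?R)" "snd \<in> borel_measurable (?R \<Otimes>\<^sub>M ?R)"
    using measurable_compose[OF measurable_fst id] measurable_compose[OF measurable_snd id] by auto
  show ?thesis by measurable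
qed

text \<open>All three measures are images of the single probability measure \<open>N\<close> on
  pairs of index and source point: \<open>\<mu>\<close> is the law of the source,
  \<open>\<nu>\<close> that of the target \<open>x i\<close>, and \<open>\<gamma>\<close> their
  joint law. There is only an inequality because \<open>\<gamma>\<close> need not be optimal,
  targets may coincide and \<open>f\<close> lies below \<open>F\<close>.\<close>

lemma reduced_energy_realisable:
  fixes \<Omega> :: "'a::euclidean_space set"
  assumes \<Omega>: "compact \<Omega>" and adm: "admissible \<Omega> x U"
    and F: "F \<in> borel_measurable borel" "\<And>t. f t \<le> F t"
    and g: "subadditive_on01 g" "lsc_on {0..1} g" "g 0 = 0"
  obtains \<mu> \<nu> where "\<mu> \<in> probs \<Omega>" "\<nu> \<in> probs \<Omega>"
    "total_energy p f g \<Omega> \<mu> \<nu> \<le> reduced_energy (\<lambda>y z. norm (y - z) powr p) F g \<Omega> x U"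
proof -
  let ?L = "lebesgue_within \<Omega>" and ?R = "restrict_space borel \<Omega>"
  let ?P = "count_space UNIV \<Otimes>\<^sub>M ?L"
  let ?c = "\<lambda>z. ennreal (norm (fst z - snd z) powr p)"
  interpret L: finite_measure ?L by (rule finite_measure_lebesgue_within[OF \<Omega>])
  have x: "x i \<in> \<Omega>" for i using adm by (auto simp: admissible_def)
  have U [measurable]: "U i \<in> borel_measurable ?L" for i using adm by (auto simp: admissible_def)
  have total: "(\<Sum>i. \<integral>\<^sup>+y. U i y \<partial>?L) = 1" using adm by (auto simp: admissible_def)
  note [measurable] = F(1)
  have UP [measurable]: "(\<lambda>(i, y). U i y) \<in> borel_measurable ?P"
    by (rule measurable_pair_measure_countable1) auto
  define N where "N = density ?P (\<lambda>(i, y). U i y)"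
  have setsN [measurable_cong, simp]: "sets N = sets ?P" by (simp add: N_def)
  have spaceN [simp]: "space N = UNIV \<times> \<Omega>" by (simp add: N_def space_pair_measure)
  have int_N: "(\<integral>\<^sup>+z. h z \<partial>N) = (\<Sum>i. \<integral>\<^sup>+y. U i y * h (i, y) \<partial>?L)"
    if [measurable]: "h \<in> borel_measurable ?P" for h
  proof -
    have "(\<integral>\<^sup>+z. h z \<partial>N) = (\<integral>\<^sup>+z. (case z of (i, y) \<Rightarrow> U i y) * h z \<partial>?P)"
      unfolding N_def by (rule nn_integral_density) auto
    also have "\<dots> = (\<integral>\<^sup>+i. \<integral>\<^sup>+y. U i y * h (i, y) \<partial>?L \<partial>count_space UNIV)"
      by (subst L.nn_integral_fst[symmetric]) auto
    finally show ?thesis by (simp add: nn_integral_count_space_nat)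
  qed
  interpret N: prob_space N
    using int_N[of "\<lambda>_. 1"] total by (intro prob_spaceI) simp
  have xfst [measurable]: "(\<lambda>z. x (fst z)) \<in> measurable N ?R"
  proof -
    have "x \<in> measurable (count_space UNIV) ?R" using x by (simp add: space_restrict_space)
    then show ?thesis by measurable
  qed
  have snd [measurable]: "snd \<in> measurable N ?R" by measurable
  have pair [measurable]: "(\<lambda>z. (snd z, x (fst z))) \<in> measurable N (?R \<Otimes>\<^sub>M ?R)" by measurable
  define \<mu> where "\<mu> = distr N ?R snd"
  define \<nu> where "\<nu> = distr N ?R (\<lambda>z. x (fst z))"
  define \<gamma> where "\<gamma> = distr N (?R \<Otimes>\<^sub>M ?R) (\<lambda>z. (snd z, x (fst z)))"
  have probs: "\<mu> \<in> probs \<Omega>" "\<nu> \<in> probs \<Omega>"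
    by (auto simp: probs_def \<mu>_def \<nu>_def intro!: N.prob_space_distr)
  have T: "transport_cost p \<Omega> \<mu> \<nu> \<le> (\<Sum>i. \<integral>\<^sup>+y. ennreal (norm (y - x i) powr p) * U i y \<partial>?L)"
  proof -
    have \<gamma>: "\<gamma> \<in> couplings \<Omega> \<mu> \<nu>"
      unfolding couplings_def \<gamma>_def \<mu>_def \<nu>_def
      by (auto intro!: N.prob_space_distr simp: distr_distr comp_def)
    have m [measurable]: "?c \<in> borel_measurable (?R \<Otimes>\<^sub>M ?R)"
      by (rule borel_measurable_power_cost)
    have m2: "(\<lambda>z. ?c (snd z, x (fst z))) \<in> borel_measurable N"
      by (rule measurable_compose[OF pair m])
    have "transport_cost p \<Omega> \<mu> \<nu> \<le> (\<integral>\<^sup>+z. ?c z \<partial>\<gamma>)"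
      unfolding transport_cost_def by (rule INF_lower[OF \<gamma>])
    also have "\<dots> = (\<integral>\<^sup>+z. ?c (snd z, x (fst z)) \<partial>N)"
      unfolding \<gamma>_def by (rule nn_integral_distr[OF pair]) (simp only: m measurable_distr_eq1)
    also have "\<dots> = (\<Sum>i. \<integral>\<^sup>+y. U i y * ennreal (norm (y - x i) powr p) \<partial>?L)"
      using m2 by (subst int_N) auto
    finally show ?thesis by (simp add: mult.commute)
  qed
  have "\<mu> = density ?L (\<lambda>y. \<Sum>i. U i y)"
  proof (rule measure_eqI)
    show "sets \<mu> = sets (density ?L (\<lambda>y. \<Sum>i. U i y))" by (simp add: \<mu>_def sets_lebesgue_within)
    fix A assume A: "A \<in> sets \<mu>"
    then have [measurable]: "A \<in> sets ?L" by (simp add: \<mu>_def sets_lebesgue_within)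
    have [measurable]: "A \<in> sets ?R" using A by (simp add: \<mu>_def)
    have "emeasure \<mu> A = (\<integral>\<^sup>+y. indicator A y \<partial>\<mu>)" using A by simp
    also have "\<dots> = (\<integral>\<^sup>+z. indicator A (snd z) \<partial>N)"
      unfolding \<mu>_def by (rule nn_integral_distr) auto
    also have "\<dots> = (\<Sum>i. \<integral>\<^sup>+y. U i y * indicator A y \<partial>?L)"
      by (subst int_N) auto
    also have "\<dots> = (\<integral>\<^sup>+y. (\<Sum>i. U i y * indicator A y) \<partial>?L)"
      by (intro nn_integral_suminf[symmetric]) auto
    also have "\<dots> = emeasure (density ?L (\<lambda>y. \<Sum>i. U i y)) A"
      by (subst emeasure_density) (auto simp: ennreal_suminf_multc)
    finally show "emeasure \<mu> A = emeasure (density ?L (\<lambda>y. \<Sum>i. U i y)) A" .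
  qed
  then have "Ffun f \<Omega> \<mu> \<le> (\<integral>\<^sup>+y. f (\<Sum>i. U i y) \<partial>?L)"
    unfolding Ffun_def by (intro Inf_lower CollectI exI[of _ "\<lambda>y. \<Sum>i. U i y"] conjI) auto
  also have "\<dots> \<le> (\<integral>\<^sup>+y. F (\<Sum>i. U i y) \<partial>?L)" by (intro nn_integral_mono F(2))
  finally have FF: "Ffun f \<Omega> \<mu> \<le> (\<integral>\<^sup>+y. F (\<Sum>i. U i y) \<partial>?L)" .
  define a where "a i = enn2real (\<integral>\<^sup>+y. U i y \<partial>?L)" for i
  have a: "ennreal (a i) = (\<integral>\<^sup>+y. U i y \<partial>?L)" "0 \<le> a i" for i
    using ennreal_enn2real_admissible[OF adm] by (auto simp: a_def)
  have sa: "summable a"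
    using total a by (intro summable_suminf_not_top) auto
  have "ennreal (suminf a) = 1" using total suminf_ennreal2[OF a(2) sa] by (simp add: a(1))
  then have suma: "suminf a = 1" by simp
  have G: "Gfun g \<nu> \<le> (\<Sum>i. g (a i))"
  proof (rule Gfun_le_of_decomposition[OF g a(2) sa])
    have single: "{z} \<in> sets ?R" if "z \<in> \<Omega>" for z
      using that by (intro countable_in_sets_restrict_borel) auto
    have cr: "range x \<in> sets ?R"
      using x by (intro countable_in_sets_restrict_borel) auto
    show "purely_atomic \<nu>"
      unfolding purely_atomic_def
    proof (intro exI[of _ "range x"] conjI)
      have "emeasure \<nu> (space \<nu> - range x) = emeasure N ((\<lambda>z. x (fst z)) -` (\<Omega> - range x) \<inter> space N)"
        unfolding \<nu>_def using sets.compl_sets[OF cr]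
        by (subst emeasure_distr) (auto simp: space_restrict_space)
      also have "(\<lambda>z. x (fst z)) -` (\<Omega> - range x) \<inter> space N = {}" by auto
      finally show "emeasure \<nu> (space \<nu> - range x) = 0" by simp
    qed (use x cr in \<open>auto simp: \<nu>_def space_restrict_space\<close>)
    fix z assume "z \<in> atoms \<nu>"
    then have z [measurable]: "{z} \<in> sets ?R"
      by (intro single) (auto simp: atoms_def \<nu>_def space_restrict_space)
    have "emeasure \<nu> {z} = (\<integral>\<^sup>+y. indicator {z} y \<partial>\<nu>)" using z by (simp add: \<nu>_def)
    also have "\<dots> = (\<integral>\<^sup>+w. indicator {z} (x (fst w)) \<partial>N)"
      unfolding \<nu>_def by (rule nn_integral_distr) auto
    also have "\<dots> = (\<Sum>i. \<integral>\<^sup>+y. U i y * indicator {z} (x i) \<partial>?L)"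
      by (subst int_N) auto
    also have "\<dots> = (\<Sum>i. ennreal (a i * indicator {z} (x i)))"
      by (intro suminf_cong) (auto simp: a nn_integral_multc indicator_def)
    also have "\<dots> = ennreal (\<Sum>i. a i * indicator {z} (x i))"
      using a by (intro suminf_ennreal2 summable_comparison_test'[OF sa]) (auto simp: indicator_def)
    finally show "measure \<nu> {z} = (\<Sum>i. a i * indicator {z} (x i))"
      using a by (auto simp: measure_def intro!: enn2real_ennreal suminf_nonneg
          summable_comparison_test'[OF sa] simp: indicator_def)
  qed (simp add: suma)
  have [measurable]: "(\<lambda>y. ennreal (norm (y - x i) powr p)) \<in> borel_measurable ?L" for i
    by (rule measurable_compose[OF measurable_restrict_space1[of "\<lambda>y. y" lborel borel]]) auto
  have "reduced_energy (\<lambda>y z. norm (y - z) powr p) F g \<Omega> x U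
     = (\<Sum>i. \<integral>\<^sup>+y. ennreal (norm (y - x i) powr p) * U i y \<partial>?L)
       + (\<integral>\<^sup>+y. F (\<Sum>i. U i y) \<partial>?L) + (\<Sum>i. g (a i))"
    unfolding reduced_energy_def a_def
    by (subst nn_integral_add) (auto simp: nn_integral_suminf)
  then have "total_energy p f g \<Omega> \<mu> \<nu> \<le> reduced_energy (\<lambda>y z. norm (y - z) powr p) F g \<Omega> x U"
    unfolding total_energy_def using T FF G by (auto intro!: add_mono)
  with probs show thesis using that by blast
qed

text \<open>The witness \<open>e\<close> is the rank in order of decreasing \<open>a\<close>, ties being broken arbitrarily.\<close>
lemma decreasing_enumeration:
  fixes a :: "'a \<Rightarrow> real"
  assumes A: "countable A" and pos: "\<And>x. x \<in> A \<Longrightarrow> 0 < a x"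
    and le1: "\<And>B. finite B \<Longrightarrow> B \<subseteq> A \<Longrightarrow> sum a B \<le> 1"
  obtains e :: "'a \<Rightarrow> nat" where "inj_on e A" "\<And>x. x \<in> A \<Longrightarrow> a x \<le> 1 / real (Suc (e x))"
proof -
  define n where "n = to_nat_on A"
  have n: "inj_on n A" unfolding n_def by (rule inj_on_to_nat_on[OF A])
  define P where "P x = {y \<in> A. a x < a y \<or> (a x = a y \<and> n y < n x)}" for x
  \<comment> \<open>Each predecessor of x has mass at least \<open>a x\<close>, so more than 1 /
    \<open>a x\<close> of them would exceed total mass 1.\<close>
  have fin: "finite (P x)" if x: "x \<in> A" for x
  proof (rule ccontr)
    assume "infinite (P x)"
    obtain k :: nat where k: "1 / a x < real k" using reals_Archimedean2 by blast
    obtain B where B: "finite B" "card B = k" "B \<subseteq> P x"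
      using infinite_arbitrarily_large[OF \<open>infinite (P x)\<close>] by blast
    have "real k * a x \<le> sum a B"
      using B by (intro sum_bounded_below[where K="a x", of B a, unfolded B(2)]) (auto simp: P_def)
    also have "\<dots> \<le> 1" using B by (intro le1) (auto simp: P_def)
    finally show False using k pos[OF x] by (simp add: field_simps)
  qed
  define e where "e x = card (P x)" for x
  have less: "e x < e y" if "x \<in> A" "y \<in> A" "x \<in> P y" for x y
    unfolding e_def using that by (intro psubset_card_mono fin) (auto simp: P_def)
  have "inj_on e A"
  proof (rule inj_onI, rule ccontr)
    fix x y assume xy: "x \<in> A" "y \<in> A" "e x = e y" "x \<noteq> y"
    then have "n x \<noteq> n y" using n by (auto dest: inj_onD)
    then have "x \<in> P y \<or> y \<in> P x" using xy by (auto simp: P_def)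
    then show False using less[of x y] less[of y x] xy by auto
  qed
  \<comment> \<open>The point x and its \<open>e x\<close> predecessors all have mass at least
    \<open>a x\<close>, and together at most 1; the \<open>Suc\<close> counts x itself.\<close>
  moreover have "a x \<le> 1 / real (Suc (e x))" if x: "x \<in> A" for x
  proof -
    have "real (card (insert x (P x))) * a x \<le> sum a (insert x (P x))"
      by (intro sum_bounded_below) (auto simp: P_def)
    also have "\<dots> \<le> 1" using x fin[OF x] by (intro le1) (auto simp: P_def)
    also have "card (insert x (P x)) = Suc (e x)"
      using fin[OF x] by (simp add: e_def) (simp add: P_def)
    finally show ?thesis by (simp add: field_simps)
  qed
  ultimately show thesis using that by blast
qed

text \<open>Because \<open>\<nu>\<close> lives on countably many atoms, no disintegration is
  required: restricting \<open>\<gamma>\<close> to one target atom and projecting to the source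
  gives a measure dominated by \<open>\<mu>\<close>, hence one with a Lebesgue density.\<close>

lemma coupling_reducible:
  fixes \<Omega> :: "'a::euclidean_space set"
  assumes \<Omega>: "compact \<Omega>" "\<Omega> \<noteq> {}" and \<mu>: "\<mu> \<in> probs \<Omega>" and \<nu>: "\<nu> \<in> probs \<Omega>"
    and \<gamma>: "\<gamma> \<in> couplings \<Omega> \<mu> \<nu>"
    and u [measurable]: "u \<in> borel_measurable (lebesgue_within \<Omega>)"
    and \<mu>u: "\<mu> = density (lebesgue_within \<Omega>) u"
    and atomic: "purely_atomic \<nu>" and g0: "g 0 = 0"
    and F [measurable]: "fix_top f \<in> borel_measurable borel"
  obtains x U where "admissible \<Omega> x U"
    "\<And>i. (\<integral>\<^sup>+y. U i y \<partial>lebesgue_within \<Omega>) \<le> ennreal (1 / real (Suc i))"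
    "reduced_energy (\<lambda>y z. norm (y - z) powr p) (fix_top f) g \<Omega> x U
      \<le> (\<integral>\<^sup>+z. ennreal (norm (fst z - snd z) powr p) \<partial>\<gamma>)
        + (\<integral>\<^sup>+y. f (u y) \<partial>lebesgue_within \<Omega>) + Gfun g \<nu>"
proof -
  let ?L = "lebesgue_within \<Omega>" and ?R = "restrict_space borel \<Omega>"
  let ?c = "\<lambda>z. ennreal (norm (fst z - snd z) powr p)"
  interpret L: finite_measure ?L by (rule finite_measure_lebesgue_within[OF \<Omega>(1)])
  interpret \<gamma>: prob_space \<gamma> using \<gamma> by (simp add: couplings_def)
  interpret \<nu>: prob_space \<nu> using \<nu> by (simp add: probs_def)
  have sets\<gamma> [measurable_cong]: "sets \<gamma> = sets (?R \<Otimes>\<^sub>M ?R)" using \<gamma> by (simp add: couplings_def)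
  have sets\<nu>: "sets \<nu> = sets ?R" using \<nu> by (simp add: probs_def)
  have space\<nu>: "space \<nu> = \<Omega>" using sets_eq_imp_space_eq[OF sets\<nu>] by (simp add: space_restrict_space)
  have \<mu>_distr: "\<mu> = distr \<gamma> ?R fst" and \<nu>_distr: "\<nu> = distr \<gamma> ?R snd"
    using \<gamma> by (auto simp: couplings_def)
  note cnt = countable_in_sets_restrict_borel
  obtain A where A: "countable A" "A \<subseteq> \<Omega>" "emeasure \<nu> (\<Omega> - A) = 0"
    using atomic by (auto simp: purely_atomic_def space\<nu>)
  have compl_A: "\<Omega> - A \<in> sets \<nu>"
    using sets.compl_sets[of A \<nu>] cnt[OF A(1,2)] by (simp add: sets\<nu> space\<nu>)
  define S where "S = atoms \<nu>"
  have S_iff: "z \<in> S \<longleftrightarrow> z \<in> \<Omega> \<and> measure \<nu> {z} > 0" for z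
    using cnt[of "{z}"] by (auto simp: S_def atoms_def space\<nu> sets\<nu>)
  have SA: "S \<subseteq> A"
  proof
    fix z assume z: "z \<in> S"
    show "z \<in> A"
    proof (rule ccontr)
      assume "z \<notin> A"
      then have "emeasure \<nu> {z} \<le> emeasure \<nu> (\<Omega> - A)"
        using z compl_A by (intro emeasure_mono) (auto simp: S_iff)
      then show False using z A(3) by (simp add: S_iff measure_def)
    qed
  qed
  have Sc: "countable S" "S \<subseteq> \<Omega>" using SA A by (auto intro: countable_subset)
  \<comment> \<open>The carrier \<open>A\<close> may contain points of mass zero; being countably
    many, they form a null set.\<close>
  have AE_S: "AE z in \<nu>. z \<in> S"
  proof (rule AE_I'[of "(\<Omega> - A) \<union> (\<Union>z\<in>A - S. {z})"])
    have "(\<Union>z\<in>A - S. {z}) \<in> null_sets \<nu>"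
    proof (rule null_sets_UN')
      fix z assume "z \<in> A - S"
      then show "{z} \<in> null_sets \<nu>"
        using A(2) cnt[of "{z}"]
        by (auto simp: null_sets_def sets\<nu> S_iff \<nu>.emeasure_eq_measure not_less measure_le_0_iff)
    qed (use A in auto)
    moreover have "\<Omega> - A \<in> null_sets \<nu>"
      using A(3) compl_A by (auto simp: null_sets_def)
    ultimately show "(\<Omega> - A) \<union> (\<Union>z\<in>A - S. {z}) \<in> null_sets \<nu>" by (intro null_sets.Un)
  qed (auto simp: space\<nu>)
  have AE_\<gamma>: "AE w in \<gamma>. snd w \<in> S"
    using AE_S unfolding \<nu>_distr by (rule AE_distrD[rotated]) measurable
  obtain e where e: "inj_on e S" "\<And>z. z \<in> S \<Longrightarrow> measure \<nu> {z} \<le> 1 / real (Suc (e z))"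
  proof (rule decreasing_enumeration[OF Sc(1), of "\<lambda>z. measure \<nu> {z}"])
    fix B assume B: "finite B" "B \<subseteq> S"
    have "(\<Sum>z\<in>B. measure \<nu> {z}) = measure \<nu> B"
      using B Sc by (intro \<nu>.finite_measure_eq_sum_singleton[symmetric]) (auto simp: sets\<nu> intro!: cnt)
    then show "(\<Sum>z\<in>B. measure \<nu> {z}) \<le> 1" by simp
  qed (auto simp: S_iff)
  define Z where "Z i = {z \<in> S. e z = i}" for i
  \<comment> \<open>An index that labels no atom gets an arbitrary point of \<open>\<Omega>\<close>.
    Its density has mass zero and \<open>g 0 = 0\<close>, so it adds nothing to the energy.\<close>
  define x where "x i = (if Z i = {} then SOME z. z \<in> \<Omega> else SOME z. z \<in> Z i)" for i
  have Z_eq: "Z i = {z}" if "z \<in> Z i" for i z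
    using that e(1) by (auto simp: Z_def dest: inj_onD)
  have x_eq: "z = x i" if "z \<in> Z i" for i z
    using Z_eq[OF that] by (auto simp: x_def)
  have x: "x i \<in> \<Omega>" for i
  proof (cases "Z i = {}")
    case True
    then show ?thesis using \<Omega>(2) by (auto simp: x_def some_in_eq)
  next
    case False
    then show ?thesis using x_eq Sc by (force simp: Z_def)
  qed
  have Zm [measurable]: "Z i \<in> sets ?R" for i
    using Sc by (intro cnt) (auto simp: Z_def intro: countable_subset)
  have sum_Z: "(\<Sum>i. indicator (Z i) z) = (indicator S z :: ennreal)" for z
  proof -
    have "(\<Sum>i. indicator (Z i) z) = (\<Sum>i\<in>{e z}. indicator (Z i) z :: ennreal)"
      by (intro suminf_finite) (auto simp: Z_def)
    then show ?thesis by (auto simp: Z_def indicator_def)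
  qed
  have split: "(\<Sum>i. \<integral>\<^sup>+w. h w * indicator (Z i) (snd w) \<partial>\<gamma>) = (\<integral>\<^sup>+w. h w \<partial>\<gamma>)"
    if [measurable]: "h \<in> borel_measurable (?R \<Otimes>\<^sub>M ?R)" for h
  proof -
    have "(\<Sum>i. \<integral>\<^sup>+w. h w * indicator (Z i) (snd w) \<partial>\<gamma>) = (\<integral>\<^sup>+w. (\<Sum>i. h w * indicator (Z i) (snd w)) \<partial>\<gamma>)"
      by (intro nn_integral_suminf[symmetric]) measurable
    also have "\<dots> = (\<integral>\<^sup>+w. h w * indicator S (snd w) \<partial>\<gamma>)" by (simp add: sum_Z)
    also have "\<dots> = (\<integral>\<^sup>+w. h w \<partial>\<gamma>)"
      using AE_\<gamma> by (intro nn_integral_cong_AE) auto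
    finally show ?thesis .
  qed
  define \<kappa> where "\<kappa> i = distr (density \<gamma> (\<lambda>w. indicator (Z i) (snd w))) ?L fst" for i
  have fstL [measurable]: "fst \<in> measurable (?R \<Otimes>\<^sub>M ?R) ?L" by measurable
  have int_\<kappa>: "(\<integral>\<^sup>+y. h y \<partial>\<kappa> i) = (\<integral>\<^sup>+w. h (fst w) * indicator (Z i) (snd w) \<partial>\<gamma>)"
    if [measurable]: "h \<in> borel_measurable ?L" for h i
    unfolding \<kappa>_def
    by (subst nn_integral_distr) (auto simp: nn_integral_density mult.commute)
  \<comment> \<open>Discarding the condition on the target bounds \<open>\<kappa> i\<close> by the
    first marginal \<open>\<mu>\<close>, which has density \<open>u\<close>.\<close>
  have "\<exists>U\<in>borel_measurable ?L. density ?L U = \<kappa> i" for i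
  proof (rule L.Radon_Nikodym)
    show "sets (\<kappa> i) = sets ?L" by (simp add: \<kappa>_def)
    show "absolutely_continuous ?L (\<kappa> i)"
      unfolding absolutely_continuous_def
    proof
      fix B assume B: "B \<in> null_sets ?L"
      then have [measurable]: "B \<in> sets ?L" "B \<in> sets ?R" by (auto simp: sets_lebesgue_within null_sets_def)
      have "emeasure (\<kappa> i) B = (\<integral>\<^sup>+y. indicator B y \<partial>\<kappa> i)" by (simp add: \<kappa>_def)
      also have "\<dots> \<le> (\<integral>\<^sup>+w. indicator B (fst w) \<partial>\<gamma>)"
        by (subst int_\<kappa>) (auto intro!: nn_integral_mono split: split_indicator)
      also have "\<dots> = (\<integral>\<^sup>+y. indicator B y \<partial>\<mu>)"
        unfolding \<mu>_distr by (subst nn_integral_distr) auto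
      also have "\<dots> = 0"
        unfolding \<mu>u using AE_not_in[OF B]
        by (subst nn_integral_density) (auto simp: nn_integral_0_iff_AE elim!: eventually_mono)
      finally show "B \<in> null_sets (\<kappa> i)" by (auto simp: null_sets_def \<kappa>_def)
    qed
  qed
  then obtain U where Um [measurable]: "\<And>i. U i \<in> borel_measurable ?L" and U: "\<And>i. density ?L (U i) = \<kappa> i"
    by metis
  have int_U: "(\<integral>\<^sup>+y. h y * U i y \<partial>?L) = (\<integral>\<^sup>+w. h (fst w) * indicator (Z i) (snd w) \<partial>\<gamma>)"
    if [measurable]: "h \<in> borel_measurable ?L" for h i
    unfolding int_\<kappa>[OF that, symmetric] U[symmetric] by (simp add: nn_integral_density mult.commute)
  have mass: "(\<integral>\<^sup>+y. U i y \<partial>?L) = emeasure \<nu> (Z i)" for i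
  proof -
    have "(\<integral>\<^sup>+y. U i y \<partial>?L) = (\<integral>\<^sup>+w. indicator (Z i) (snd w) \<partial>\<gamma>)" using int_U[of "\<lambda>_. 1"] by simp
    also have "\<dots> = (\<integral>\<^sup>+z. indicator (Z i) z \<partial>\<nu>)" unfolding \<nu>_distr by (subst nn_integral_distr) auto
    finally show ?thesis using Zm by (simp add: sets\<nu>)
  qed
  have adm: "admissible \<Omega> x U"
    unfolding admissible_def
  proof (intro conjI allI)
    show "(\<Sum>i. \<integral>\<^sup>+y. U i y \<partial>?L) = 1"
      using split[of "\<lambda>_. 1"] int_U[of "\<lambda>_. 1"] by (simp add: \<gamma>.emeasure_space_1)
  qed (use x in auto)
  have small: "(\<integral>\<^sup>+y. U i y \<partial>?L) \<le> ennreal (1 / real (Suc i))" for i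
  proof (cases "Z i = {}")
    case False
    then obtain z where z: "z \<in> Z i" by blast
    then show ?thesis unfolding mass Z_eq[OF z] \<nu>.emeasure_eq_measure
      using e(2)[of z] z by (intro ennreal_leI) (auto simp: Z_def)
  qed (simp add: mass)
  have "density ?L (\<lambda>y. \<Sum>i. U i y) = density ?L u"
  proof (rule measure_eqI)
    fix B assume "B \<in> sets (density ?L (\<lambda>y. \<Sum>i. U i y))"
    then have [measurable]: "B \<in> sets ?L" "B \<in> sets ?R" by (auto simp: sets_lebesgue_within)
    have "emeasure (density ?L (\<lambda>y. \<Sum>i. U i y)) B = (\<integral>\<^sup>+y. (\<Sum>i. indicator B y * U i y) \<partial>?L)"
      by (subst emeasure_density) (auto simp: ennreal_suminf_cmult mult.commute)
    also have "\<dots> = (\<Sum>i. \<integral>\<^sup>+w. indicator B (fst w) * indicator (Z i) (snd w) \<partial>\<gamma>)"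
      by (subst nn_integral_suminf) (auto simp: int_U)
    also have "\<dots> = (\<integral>\<^sup>+w. indicator B (fst w) \<partial>\<gamma>)" by (rule split) measurable
    also have "\<dots> = (\<integral>\<^sup>+y. indicator B y \<partial>\<mu>)" unfolding \<mu>_distr by (subst nn_integral_distr) auto
    also have "\<dots> = emeasure (density ?L u) B" by (simp add: \<mu>u)
    finally show "emeasure (density ?L (\<lambda>y. \<Sum>i. U i y)) B = emeasure (density ?L u) B" .
  qed simp
  then have AE_u: "AE y in ?L. (\<Sum>i. U i y) = u y"
    by (intro L.density_unique) auto
  \<comment> \<open>Total mass 1 makes \<open>u\<close> finite almost everywhere, so
    \<open>fix_top f\<close> and \<open>f\<close> agree along it.\<close>
  have "(\<integral>\<^sup>+y. u y \<partial>?L) = (\<integral>\<^sup>+y. 1 \<partial>\<mu>)"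
    unfolding \<mu>u by (subst nn_integral_density) auto
  also have "\<dots> = 1" using \<mu> by (simp add: probs_def prob_space.emeasure_space_1)
  finally have "AE y in ?L. u y \<noteq> \<infinity>" by (intro nn_integral_PInf_AE) auto
  then have F_eq: "(\<integral>\<^sup>+y. fix_top f (\<Sum>i. U i y) \<partial>?L) = (\<integral>\<^sup>+y. f (u y) \<partial>?L)"
    using AE_u by (intro nn_integral_cong_AE) (auto simp: fix_top_def)
  have cm [measurable]: "?c \<in> borel_measurable (?R \<Otimes>\<^sub>M ?R)" by (rule borel_measurable_power_cost)
  have cL [measurable]: "(\<lambda>y. ennreal (norm (y - x i) powr p)) \<in> borel_measurable ?L" for i
    by (rule measurable_compose[OF measurable_restrict_space1[of "\<lambda>y. y" lborel borel]]) auto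
  have T_eq: "(\<Sum>i. \<integral>\<^sup>+y. ennreal (norm (y - x i) powr p) * U i y \<partial>?L) = (\<integral>\<^sup>+w. ?c w \<partial>\<gamma>)"
  proof -
    \<comment> \<open>On the piece of \<open>\<gamma>\<close> with target in \<open>Z i\<close> the
      second coordinate equals \<open>x i\<close>, so the cost there depends on the first coordinate
      alone.\<close>
    have "(\<integral>\<^sup>+y. ennreal (norm (y - x i) powr p) * U i y \<partial>?L) = (\<integral>\<^sup>+w. ?c w * indicator (Z i) (snd w) \<partial>\<gamma>)" for i
      unfolding int_U[OF cL]
      by (intro nn_integral_cong) (auto split: split_indicator dest: x_eq)
    then show ?thesis using split[OF cm] by simp
  qed
  have G_eq: "(\<Sum>i. g (enn2real (\<integral>\<^sup>+y. U i y \<partial>?L))) = Gfun g \<nu>"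
  proof -
    \<comment> \<open>Here distinct indices label distinct atoms, so reindexing along the injective
      \<open>e\<close> gives an equality; the indices outside its range contribute
      \<open>g 0 = 0\<close>.\<close>
    have "Gfun g \<nu> = (\<integral>\<^sup>+z. g (measure \<nu> (Z (e z))) \<partial>count_space S)"
      using atomic Z_eq by (auto simp: Gfun_def S_def[symmetric] Z_def intro!: nn_integral_cong)
    also have "\<dots> = (\<integral>\<^sup>+i. g (measure \<nu> (Z i)) \<partial>count_space (e ` S))"
      using e(1) by (intro nn_integral_bij_count_space[of e S "e ` S" "\<lambda>i. g (measure \<nu> (Z i))"])
        (auto simp: bij_betw_def)
    also have "\<dots> = (\<integral>\<^sup>+i. g (measure \<nu> (Z i)) * indicator (e ` S) i \<partial>count_space UNIV)"
      by (simp add: nn_integral_count_space_indicator)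
    also have "\<dots> = (\<integral>\<^sup>+i. g (measure \<nu> (Z i)) \<partial>count_space UNIV)"
    proof (intro nn_integral_cong)
      fix i
      have "Z i = {}" if "i \<notin> e ` S" using that by (auto simp: Z_def)
      then show "g (measure \<nu> (Z i)) * indicator (e ` S) i = g (measure \<nu> (Z i))"
        by (cases "i \<in> e ` S") (auto simp: g0)
    qed
    finally show ?thesis by (simp add: mass nn_integral_count_space_nat measure_def)
  qed
  have "reduced_energy (\<lambda>y z. norm (y - z) powr p) (fix_top f) g \<Omega> x U
     = (\<Sum>i. \<integral>\<^sup>+y. ennreal (norm (y - x i) powr p) * U i y \<partial>?L)
       + (\<integral>\<^sup>+y. fix_top f (\<Sum>i. U i y) \<partial>?L) + (\<Sum>i. g (enn2real (\<integral>\<^sup>+y. U i y \<partial>?L)))"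
    unfolding reduced_energy_def
    by (subst nn_integral_add) (auto simp: nn_integral_suminf)
  then have "reduced_energy (\<lambda>y z. norm (y - z) powr p) (fix_top f) g \<Omega> x U
      \<le> (\<integral>\<^sup>+z. ?c z \<partial>\<gamma>) + (\<integral>\<^sup>+y. f (u y) \<partial>?L) + Gfun g \<nu>"
    by (simp add: T_eq F_eq G_eq)
  with adm small show thesis using that by blast
qed

section \<open>Existence of a minimiser\<close>

text \<open>The diagonal argument is hidden in the product topology: the product of the
  \<open>S i\<close> is compact by Tychonoff's theorem, and a countable product of metric spaces is
  first countable, so compactness yields convergent subsequences.\<close>

lemma diagonal_convergent_subsequence:
  fixes X :: "nat \<Rightarrow> nat \<Rightarrow> 'b::metric_space"
  assumes S: "\<And>i. compact (S i)" and X: "\<And>k i. X k i \<in> S i"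
  obtains l r where "strict_mono r" "\<And>i. l i \<in> S i" "\<And>i. (\<lambda>k. X (r k) i) \<longlonglongrightarrow> l i"
proof -
  have "compactin (product_topology (\<lambda>i. euclidean) UNIV) (PiE UNIV S)"
    using S by (simp add: compactin_PiE)
  then have "compact (PiE UNIV S)" by (simp add: euclidean_product_topology)
  then have "seq_compact (PiE UNIV S)" by (rule compact_imp_seq_compact)
  moreover have "\<forall>k. X k \<in> PiE UNIV S" using X by (auto simp: PiE_iff)
  ultimately obtain l r where lr: "l \<in> PiE UNIV S" "strict_mono r" "(X \<circ> r) \<longlonglongrightarrow> l"
    by (rule seq_compactE)
  have "(\<lambda>k. X (r k) i) \<longlonglongrightarrow> l i" for i
  proof -
    have "continuous_on UNIV (\<lambda>f::nat \<Rightarrow> 'b. f i)"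
      using continuous_on_product_then_coordinatewise[OF continuous_on_id] by simp
    from continuous_on_tendsto_compose[OF this lr(3)] show ?thesis by (simp add: comp_def)
  qed
  then show thesis using that[of r l] lr by (auto simp: PiE_iff)
qed

section \<open>Limits and midpoints in [0, \<infinity>]\<close>

text \<open>Tail suprema and infima serve as bounds that only tighten with k and yet keep the limit;
  this lets constraint sets be nested and still be sharp in the limit.\<close>

lemma tendsto_tail_SUP:
  fixes X :: "nat \<Rightarrow> 'a::{complete_linorder,linorder_topology}"
  assumes "X \<longlonglongrightarrow> l"
  shows "(\<lambda>k. SUP j\<in>{k..}. X j) \<longlonglongrightarrow> l"
proof -
  have "decseq (\<lambda>k. SUP j\<in>{k..}. X j)" by (auto simp: decseq_def intro!: SUP_subset_mono)
  from LIMSEQ_INF[OF this] show ?thesis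
    using lim_imp_Limsup[OF _ assms] by (simp add: limsup_INF_SUP)
qed

lemma tendsto_tail_INF:
  fixes X :: "nat \<Rightarrow> 'a::{complete_linorder,linorder_topology}"
  assumes "X \<longlonglongrightarrow> l"
  shows "(\<lambda>k. INF j\<in>{k..}. X j) \<longlonglongrightarrow> l"
proof -
  have "incseq (\<lambda>k. INF j\<in>{k..}. X j)" by (auto simp: incseq_def intro!: INF_superset_mono)
  from LIMSEQ_SUP[OF this] show ?thesis
    using lim_imp_Liminf[OF _ assms] by (simp add: liminf_SUP_INF)
qed

text \<open>Fatou's lemma for the counting measure on the indices.\<close>

lemma suminf_liminf_le:
  fixes u :: "nat \<Rightarrow> nat \<Rightarrow> ennreal"
  shows "(\<Sum>i. liminf (\<lambda>k. u k i)) \<le> liminf (\<lambda>k. \<Sum>i. u k i)"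
  using nn_integral_liminf[of u "count_space UNIV"] by (simp add: nn_integral_count_space_nat)

text \<open>Fatou's lemma on a space with two points.\<close>

lemma liminf_add_le_ennreal:
  fixes u v :: "nat \<Rightarrow> ennreal"
  shows "liminf u + liminf v \<le> liminf (\<lambda>k. u k + v k)"
  using nn_integral_liminf[of "\<lambda>k b. if b then u k else v k" "count_space (UNIV :: bool set)"]
  by (simp add: nn_integral_count_space_finite UNIV_bool add.commute)

lemma ennreal_add_self_half: "(a + a) / 2 = (a::ennreal)"
proof -
  have "(a + a) / 2 = a * 2 / 2" by (simp add: mult_2_right)
  also have "\<dots> = a" by (intro ennreal_mult_divide_eq) auto
  finally show ?thesis .
qed

lemma ennreal_midpoint_le: "s \<le> a \<Longrightarrow> t \<le> a \<Longrightarrow> (s + t) / 2 \<le> (a::ennreal)"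
  using divide_right_mono_ennreal[OF add_mono[of s a t a], of 2] by (simp add: ennreal_add_self_half)

lemma ennreal_midpoint_ge: "a \<le> s \<Longrightarrow> a \<le> t \<Longrightarrow> (a::ennreal) \<le> (s + t) / 2"
  using divide_right_mono_ennreal[OF add_mono[of a s a t], of 2] by (simp add: ennreal_add_self_half)

text \<open>Uniformity in y matters because the error is integrated against densities that change
  with k and are controlled only through their masses.\<close>

lemma uniform_cost_convergence:
  fixes c :: "'a::euclidean_space \<Rightarrow> 'a \<Rightarrow> real"
  assumes \<Omega>: "compact \<Omega>" and c: "continuous_on (\<Omega> \<times> \<Omega>) (\<lambda>(y, z). c y z)"
    and X: "\<And>k. X k \<in> \<Omega>" "l \<in> \<Omega>" "X \<longlonglongrightarrow> l"
  shows "(\<lambda>k. SUP y\<in>\<Omega>. ennreal \<bar>c y (X k) - c y l\<bar>) \<longlonglongrightarrow> 0"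
proof (rule order_tendstoI)
  fix \<epsilon> :: ennreal assume "0 < \<epsilon>"
  then obtain d' where d': "0 < d'" "d' < \<epsilon>" using dense by blast
  then have "d' < top" using less_top[of d'] by auto
  then obtain d where d: "d' = ennreal d" "0 < d" using d'(1) by (cases d') auto
  have "uniformly_continuous_on (\<Omega> \<times> \<Omega>) (\<lambda>(y, z). c y z)"
    using c \<Omega> by (intro compact_uniformly_continuous compact_Times)
  then obtain \<delta> where \<delta>: "0 < \<delta>"
    "\<And>w w'. w \<in> \<Omega> \<times> \<Omega> \<Longrightarrow> w' \<in> \<Omega> \<times> \<Omega> \<Longrightarrow> dist w' w < \<delta> \<Longrightarrow> dist (case w' of (y, z) \<Rightarrow> c y z) (case w of (y, z) \<Rightarrow> c y z) < d"
    unfolding uniformly_continuous_on_def using d(2) by metis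
  have "\<forall>\<^sub>F k in sequentially. dist (X k) l < \<delta>" using X(3) \<delta>(1) by (rule tendstoD)
  then show "\<forall>\<^sub>F k in sequentially. (SUP y\<in>\<Omega>. ennreal \<bar>c y (X k) - c y l\<bar>) < \<epsilon>"
  proof eventually_elim
    case (elim k)
    have "\<bar>c y (X k) - c y l\<bar> < d" if "y \<in> \<Omega>" for y
      using \<delta>(2)[of "(y, l)" "(y, X k)"] that X elim by (auto simp: dist_Pair_Pair dist_real_def)
    then have "(SUP y\<in>\<Omega>. ennreal \<bar>c y (X k) - c y l\<bar>) \<le> d'"
      unfolding d(1) by (intro SUP_least ennreal_leI) (auto intro: less_imp_le)
    then show ?case using d'(2) by (rule le_less_trans)
  qed
qed auto

text \<open>The superlinearity of \<open>g\<close> at \<open>0\<close> prevents mass from escaping into infinitely many small atoms.\<close>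
lemma atomic_masses_conserved:
  fixes a :: "nat \<Rightarrow> nat \<Rightarrow> real"
  assumes a0: "\<And>k i. 0 \<le> a k i" and a1: "\<And>k i. a k i \<le> 1 / real (Suc i)"
    and total: "\<And>k. (\<Sum>i. ennreal (a k i)) = 1"
    and lim: "\<And>i. (\<lambda>k. a k i) \<longlonglongrightarrow> l i"
    and sup: "((\<lambda>t. g t / ennreal t) \<longlongrightarrow> \<infinity>) (at_right 0)"
    and B: "\<And>k. (\<Sum>i. g (a k i)) \<le> ennreal B" and B0: "0 \<le> B"
  shows "(\<Sum>i. ennreal (l i)) = 1"
proof (rule antisym)
  have lim': "(\<lambda>k. \<Sum>i<n. ennreal (a k i)) \<longlonglongrightarrow> (\<Sum>i<n. ennreal (l i))" for n
    by (intro tendsto_sum tendsto_ennrealI lim)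
  show "(\<Sum>i. ennreal (l i)) \<le> 1"
  proof (rule suminf_le_const)
    fix n
    show "(\<Sum>i<n. ennreal (l i)) \<le> 1"
    proof (rule LIMSEQ_le_const2[OF lim'], intro exI allI impI)
      fix k
      show "(\<Sum>i<n. ennreal (a k i)) \<le> 1"
        unfolding total[of k, symmetric] by (intro sum_le_suminf) auto
    qed
  qed auto
  show "1 \<le> (\<Sum>i. ennreal (l i))"
  proof (rule ennreal_le_epsilon)
    fix \<epsilon> :: real assume \<epsilon>: "0 < \<epsilon>"
    \<comment> \<open>With this slope the mass of small atoms is at most B / M \<le> \<epsilon>; the
      added 1 keeps \<open>M\<close> positive when B = 0.\<close>
    define M where "M = (B + 1) / \<epsilon>"
    have M: "0 < M" "B / M \<le> \<epsilon>" using B0 \<epsilon> by (auto simp: M_def field_simps)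
    obtain \<delta> where \<delta>: "0 < \<delta>" "\<And>t. 0 < t \<Longrightarrow> t < \<delta> \<Longrightarrow> ennreal M * ennreal t \<le> g t"
      using superlinear_at_0D[OF sup] by blast
    \<comment> \<open>By \<open>a1\<close>, all masses from index n on lie below
      \<open>\<delta>\<close>, simultaneously for every k.\<close>
    obtain n where n: "1 / real (Suc n) < \<delta>" using nat_approx_posE[OF \<delta>(1)] by blast
    have Mg: "ennreal M * ennreal (a k (i + n)) \<le> g (a k (i + n))" for k i
    proof (cases "a k (i + n) = 0")
      case False
      have "a k (i + n) \<le> 1 / real (Suc (i + n))" by (rule a1)
      also have "\<dots> \<le> 1 / real (Suc n)" by (intro divide_left_mono) auto
      also note n
      finally show ?thesis using False a0[of k "i + n"] by (intro \<delta>(2)) auto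
    qed simp
    have "1 \<le> (\<Sum>i<n. ennreal (a k i)) + ennreal \<epsilon>" for k
    proof -
      have "ennreal M * (\<Sum>i. ennreal (a k (i + n))) \<le> (\<Sum>i. g (a k (i + n)))"
        unfolding ennreal_suminf_cmult[symmetric] by (intro suminf_le Mg) auto
      also have "\<dots> \<le> (\<Sum>i. g (a k i))"
        unfolding suminf_offset[of "\<lambda>i. g (a k i)" n, OF summableI] by simp
      also have "\<dots> \<le> ennreal B" by (rule B)
      finally have "(\<Sum>i. ennreal (a k (i + n))) * ennreal M / ennreal M \<le> ennreal B / ennreal M"
        by (intro divide_right_mono_ennreal) (simp add: mult.commute)
      then have "(\<Sum>i. ennreal (a k (i + n))) \<le> ennreal (B / M)"
        using M B0 by (simp add: ennreal_mult_divide_eq divide_ennreal)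
      also have "\<dots> \<le> ennreal \<epsilon>" using M by (intro ennreal_leI)
      finally show ?thesis
        unfolding total[of k, symmetric] suminf_offset[of "\<lambda>i. ennreal (a k i)" n, OF summableI]
        by (subst add.commute) (intro add_left_mono)
    qed
    moreover have "(\<lambda>k. (\<Sum>i<n. ennreal (a k i)) + ennreal \<epsilon>) \<longlonglongrightarrow> (\<Sum>i<n. ennreal (l i)) + ennreal \<epsilon>"
      by (intro tendsto_add lim') auto
    ultimately have "1 \<le> (\<Sum>i<n. ennreal (l i)) + ennreal \<epsilon>"
      by (intro LIMSEQ_le_const) auto
    also have "\<dots> \<le> (\<Sum>i. ennreal (l i)) + ennreal \<epsilon>"
      by (intro add_right_mono sum_le_suminf) auto
    finally show "1 \<le> (\<Sum>i. ennreal (l i)) + ennreal \<epsilon>" .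
  qed
qed

text \<open>Weak compactness of the densities is replaced by convexity: the sets \<open>C k\<close> of densities obeying
  all bounds satisfied by the tail of the sequence are convex and decreasing, so almost everywhere
  convergent elements can be selected, and superlinearity of \<open>F\<close> keeps their masses.\<close>
lemma reduced_lower_semicontinuity:
  fixes \<Omega> :: "'a::euclidean_space set" and c :: "'a \<Rightarrow> 'a \<Rightarrow> real"
  assumes \<Omega>: "compact \<Omega>"
    and c: "continuous_on (\<Omega> \<times> \<Omega>) (\<lambda>(y, z). c y z)" and c0: "\<And>y z. 0 \<le> c y z"
    and F_mono: "mono F" and F_mid: "\<And>s t. F ((s + t) / 2) \<le> (F s + F t) / 2"
    and F_lsc: "\<And>X t. t \<le> liminf X \<Longrightarrow> F t \<le> liminf (\<lambda>k::nat. F (X k))"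
    and F_sup: "\<And>M::real. \<exists>R::real. \<forall>t. ennreal R \<le> t \<longrightarrow> ennreal M * t \<le> F t"
    and x: "\<And>k i. x k i \<in> \<Omega>" "\<And>i. xl i \<in> \<Omega>" "\<And>i. (\<lambda>k. x k i) \<longlonglongrightarrow> xl i"
    and U: "\<And>k i. U k i \<in> borel_measurable (lebesgue_within \<Omega>)"
    and a: "\<And>k i. (\<integral>\<^sup>+y. U k i y \<partial>lebesgue_within \<Omega>) = a k i" "\<And>k i. a k i \<le> 1"
      "\<And>i. (\<lambda>k. a k i) \<longlonglongrightarrow> al i"
    and K: "\<And>k. (\<integral>\<^sup>+y. (\<Sum>i. ennreal (c y (x k i)) * U k i y) + F (\<Sum>i. U k i y) \<partial>lebesgue_within \<Omega>) = K k"
      "K \<longlonglongrightarrow> Kl" "\<And>k. K k \<le> ennreal B" "0 \<le> B"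
  obtains V where "\<And>i. V i \<in> borel_measurable (lebesgue_within \<Omega>)"
    "\<And>i. (\<integral>\<^sup>+y. V i y \<partial>lebesgue_within \<Omega>) = al i"
    "(\<integral>\<^sup>+y. (\<Sum>i. ennreal (c y (xl i)) * V i y) + F (\<Sum>i. V i y) \<partial>lebesgue_within \<Omega>) \<le> Kl"
proof -
  let ?L = "lebesgue_within \<Omega>"
  let ?P = "count_space UNIV \<Otimes>\<^sub>M ?L"
  \<comment> \<open>The selection lemma wants a finite measure, which counting measure on the
    indices would not provide. Geometric weights are finite and positive at every index, so almost
    everywhere statements still pass to each slice.\<close>
  let ?M = "measure_pmf (geometric_pmf (1/2)) \<Otimes>\<^sub>M ?L"
  interpret L: finite_measure ?L by (rule finite_measure_lebesgue_within[OF \<Omega>])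
  interpret geo: prob_space "measure_pmf (geometric_pmf (1/2))" by (rule measure_pmf.prob_space_axioms)
  interpret M: pair_sigma_finite "measure_pmf (geometric_pmf (1/2))" ?L ..
  note [measurable] = U borel_measurable_mono_ennreal[OF F_mono]
  have setsM [measurable_cong]: "sets ?M = sets ?P" by (intro sets_pair_measure_cong) simp_all
  have finM: "finite_measure ?M"
    by (intro finite_measure_pair_measure) unfold_locales
  have cm [measurable]: "(\<lambda>y. ennreal (c y z)) \<in> borel_measurable ?L" if "z \<in> \<Omega>" for z
  proof -
    have "continuous_on \<Omega> (\<lambda>y. (\<lambda>(y, z). c y z) (y, z))"
      using that by (intro continuous_on_compose2[OF c]) (auto intro!: continuous_intros)
    then have "(\<lambda>y. c y z) \<in> borel_measurable (restrict_space borel \<Omega>)"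
      by (intro borel_measurable_continuous_on_restrict) simp
    then show ?thesis by measurable
  qed
  note cx [measurable] = cm[OF x(1)] cm[OF x(2)]
  define e where "e j i = (SUP y\<in>\<Omega>. ennreal \<bar>c y (x j i) - c y (xl i)\<bar>)" for j i
  have e: "(\<lambda>j. e j i) \<longlonglongrightarrow> 0" for i
    unfolding e_def using \<Omega> c x by (intro uniform_cost_convergence) auto
  \<comment> \<open>The points are frozen at their limits and only N cost terms are kept, since
    \<open>e j i\<close> tends to 0 for each i separately. The integrand \<open>F\<close> sees the
    full sum; N = 0 isolates it.\<close>
  define q where "q N v y = (\<Sum>i<N. ennreal (c y (xl i)) * v (i, y)) + F (\<Sum>i. v (i, y))"
    for N and v :: "nat \<times> 'a \<Rightarrow> ennreal" and y
  have qm [measurable]: "q N v \<in> borel_measurable ?L" if [measurable]: "v \<in> borel_measurable ?P" for N v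
    unfolding q_def by measurable
  define D where "D k N = (SUP j\<in>{k..}. K j + (\<Sum>i<N. e j i))" for k N
  define C where "C k = {v \<in> borel_measurable ?P.
      (\<forall>i. (INF j\<in>{k..}. a j i) \<le> (\<integral>\<^sup>+y. v (i, y) \<partial>?L) \<and> (\<integral>\<^sup>+y. v (i, y) \<partial>?L) \<le> (SUP j\<in>{k..}. a j i)) \<and>
      (\<forall>N. (\<integral>\<^sup>+y. q N v y \<partial>?L) \<le> D k N)}" for k
  have dec: "decseq C"
  proof (rule decseq_SucI)
    fix k
    have "{Suc k..} \<subseteq> {k..}" by auto
    then have "(INF j\<in>{k..}. a j i) \<le> (INF j\<in>{Suc k..}. a j i)"
      "(SUP j\<in>{Suc k..}. a j i) \<le> (SUP j\<in>{k..}. a j i)" "D (Suc k) N \<le> D k N" for i N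
      unfolding D_def by (auto intro!: INF_superset_mono SUP_subset_mono)
    then show "C (Suc k) \<subseteq> C k" unfolding C_def by (blast intro: order_trans)
  qed
  have "(\<lambda>(i, y). U k i y) \<in> C k" for k
  proof -
    have [measurable]: "(\<lambda>(i, y). U k i y) \<in> borel_measurable ?P"
      by (rule measurable_pair_measure_countable1) auto
    have "(\<integral>\<^sup>+y. q N (\<lambda>(i, y). U k i y) y \<partial>?L) \<le> K k + (\<Sum>i<N. e k i)" for N
    proof -
      have "q N (\<lambda>(i, y). U k i y) y \<le> ((\<Sum>i. ennreal (c y (x k i)) * U k i y) + F (\<Sum>i. U k i y))
          + (\<Sum>i<N. e k i * U k i y)" if y: "y \<in> space ?L" for y
      proof -
        have "ennreal (c y (xl i)) \<le> ennreal (c y (x k i)) + e k i" for i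
        proof -
          have "ennreal (c y (xl i)) \<le> ennreal (c y (x k i) + \<bar>c y (x k i) - c y (xl i)\<bar>)"
            by (intro ennreal_leI) auto
          also have "\<dots> = ennreal (c y (x k i)) + ennreal \<bar>c y (x k i) - c y (xl i)\<bar>"
            by (intro ennreal_plus c0) auto
          also have "\<dots> \<le> ennreal (c y (x k i)) + e k i"
            unfolding e_def using y by (intro add_left_mono SUP_upper) auto
          finally show ?thesis .
        qed
        then have "(\<Sum>i<N. ennreal (c y (xl i)) * U k i y) \<le> (\<Sum>i<N. (ennreal (c y (x k i)) + e k i) * U k i y)"
          by (intro sum_mono mult_right_mono) auto
        also have "\<dots> = (\<Sum>i<N. ennreal (c y (x k i)) * U k i y) + (\<Sum>i<N. e k i * U k i y)"
          by (simp add: distrib_right sum.distrib)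
        also have "\<dots> \<le> (\<Sum>i. ennreal (c y (x k i)) * U k i y) + (\<Sum>i<N. e k i * U k i y)"
          by (intro add_right_mono sum_le_suminf) auto
        finally show ?thesis
          unfolding q_def by (simp add: add_right_mono add.commute add.left_commute)
      qed
      then have "(\<integral>\<^sup>+y. q N (\<lambda>(i, y). U k i y) y \<partial>?L)
          \<le> (\<integral>\<^sup>+y. ((\<Sum>i. ennreal (c y (x k i)) * U k i y) + F (\<Sum>i. U k i y)) + (\<Sum>i<N. e k i * U k i y) \<partial>?L)"
        by (intro nn_integral_mono)
      also have "\<dots> = K k + (\<Sum>i<N. e k i * a k i)"
        unfolding K(1)[symmetric] a(1)[symmetric]
        by (subst nn_integral_add) (auto simp: nn_integral_sum nn_integral_cmult)
      also have "\<dots> \<le> K k + (\<Sum>i<N. e k i * 1)"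
        by (intro add_left_mono sum_mono mult_left_mono a) auto
      finally show ?thesis by simp
    qed
    then show ?thesis
      unfolding C_def D_def by (auto simp: a(1) intro: INF_lower SUP_upper SUP_upper2)
  qed
  then have ne: "C k \<noteq> {}" for k by blast
  have meas: "v \<in> borel_measurable ?M" if "v \<in> C k" for v k
    using that by (simp add: C_def cong: measurable_cong_sets[OF setsM refl])
  have mid: "(\<lambda>p. (v p + w p) / 2) \<in> C k" if "v \<in> C k" "w \<in> C k" for v w k
  proof -
    have [measurable]: "v \<in> borel_measurable ?P" "w \<in> borel_measurable ?P" using that by (auto simp: C_def)
    have "(\<integral>\<^sup>+y. (v (i, y) + w (i, y)) / 2 \<partial>?L) = ((\<integral>\<^sup>+y. v (i, y) \<partial>?L) + (\<integral>\<^sup>+y. w (i, y) \<partial>?L)) / 2" for i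
      by (simp add: nn_integral_divide nn_integral_add)
    moreover have "(\<integral>\<^sup>+y. q N (\<lambda>p. (v p + w p) / 2) y \<partial>?L) \<le> D k N" for N
    proof -
      have "q N (\<lambda>p. (v p + w p) / 2) y \<le> (q N v y + q N w y) / 2" for y
      proof -
        have "(\<Sum>i<N. ennreal (c y (xl i)) * ((v (i, y) + w (i, y)) / 2))
          = ((\<Sum>i<N. ennreal (c y (xl i)) * v (i, y)) + (\<Sum>i<N. ennreal (c y (xl i)) * w (i, y))) / 2"
          by (simp add: divide_ennreal_def distrib_left sum.distrib sum_distrib_right[symmetric]
              mult.assoc[symmetric])
        moreover have "F (\<Sum>i. (v (i, y) + w (i, y)) / 2) \<le> (F (\<Sum>i. v (i, y)) + F (\<Sum>i. w (i, y))) / 2"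
          using F_mid[of "\<Sum>i. v (i, y)" "\<Sum>i. w (i, y)"] by (simp add: suminf_add)
        ultimately show ?thesis
          unfolding q_def by (simp add: add_divide_distrib_ennreal add_left_mono ac_simps)
      qed
      then have "(\<integral>\<^sup>+y. q N (\<lambda>p. (v p + w p) / 2) y \<partial>?L) \<le> (\<integral>\<^sup>+y. (q N v y + q N w y) / 2 \<partial>?L)"
        by (intro nn_integral_mono)
      also have "\<dots> = ((\<integral>\<^sup>+y. q N v y \<partial>?L) + (\<integral>\<^sup>+y. q N w y \<partial>?L)) / 2"
        by (simp add: nn_integral_divide nn_integral_add)
      also have "\<dots> \<le> D k N" using that by (intro ennreal_midpoint_le) (auto simp: C_def)
      finally show ?thesis .
    qed
    ultimately show ?thesis
      using that unfolding C_def by (auto intro!: ennreal_midpoint_le ennreal_midpoint_ge)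
  qed
  obtain v where v: "\<And>k. v k \<in> C k" and conv: "AE p in ?M. convergent (\<lambda>k. v k p)"
  proof (rule midpoint_convex_AE_convergent_selection[OF finM dec ne])
    show "\<And>k v. v \<in> C k \<Longrightarrow> v \<in> borel_measurable ?M" by (rule meas)
    show "\<And>k v w. v \<in> C k \<Longrightarrow> w \<in> C k \<Longrightarrow> (\<lambda>p. (v p + w p) / 2) \<in> C k" by (rule mid)
  qed (rule that)
  have vm [measurable]: "v k \<in> borel_measurable ?P" for k using v by (auto simp: C_def)
  \<comment> \<open>The lower limit exists everywhere and is measurable; it agrees with the limit
    wherever the selection converges.\<close>
  define V where "V i y = liminf (\<lambda>k. v k (i, y))" for i y
  have Vm [measurable]: "V i \<in> borel_measurable ?L" for i unfolding V_def by measurable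
  have "AE y in ?L. (\<lambda>k. v k (i, y)) \<longlonglongrightarrow> V i y" for i
  proof -
    have "AE y in ?L. convergent (\<lambda>k. v k (i, y))"
      using M.AE_pair[OF conv] by (simp add: AE_measure_pmf_iff set_pmf_geometric)
    then show ?thesis
      unfolding V_def by eventually_elim (metis convergent_LIMSEQ_iff convergent_liminf_cl)
  qed
  then have conv: "AE y in ?L. \<forall>i. (\<lambda>k. v k (i, y)) \<longlonglongrightarrow> V i y"
    by (simp add: AE_all_countable)
  have mass_le: "(\<integral>\<^sup>+y. V i y \<partial>?L) \<le> al i" for i
  proof -
    have "(\<integral>\<^sup>+y. V i y \<partial>?L) \<le> liminf (\<lambda>k. \<integral>\<^sup>+y. v k (i, y) \<partial>?L)"
      unfolding V_def by (intro nn_integral_liminf) measurable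
    also have "\<dots> \<le> liminf (\<lambda>k. SUP j\<in>{k..}. a j i)"
      using v by (intro Liminf_mono always_eventually) (auto simp: C_def)
    also have "\<dots> = al i" by (intro lim_imp_Liminf tendsto_tail_SUP a) auto
    finally show ?thesis .
  qed
  have mass_ge: "al i \<le> (\<integral>\<^sup>+y. V i y \<partial>?L)" for i
  proof (rule ennreal_le_epsilon)
    fix \<epsilon> :: real assume \<epsilon>: "0 < \<epsilon>"
    define m where "m = (B + 1) / \<epsilon>"
    have m: "0 < m" "B / m \<le> \<epsilon>" using K(4) \<epsilon> by (auto simp: m_def field_simps)
    obtain R :: real where R: "\<And>t. ennreal R \<le> t \<Longrightarrow> ennreal m * t \<le> F t" using F_sup by blast
    have "(INF j\<in>{k..}. a j i) \<le> (\<integral>\<^sup>+y. min (v k (i, y)) (ennreal R) \<partial>?L) + ennreal \<epsilon>" for k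
    proof -
      \<comment> \<open>Uniform integrability by truncation: where \<open>v k\<close> exceeds R,
        superlinearity bounds it by \<open>q 0 (v k) y / ennreal m\<close>. The excess has integral
        at most B / m \<le> \<epsilon> for every k, and dominated convergence applies to the
        truncated part.\<close>
      have ptw: "v k (i, y) \<le> min (v k (i, y)) (ennreal R) + q 0 (v k) y / ennreal m" for y
      proof (cases "v k (i, y) \<le> ennreal R")
        case False
        have "v k (i, y) \<le> (\<Sum>i. v k (i, y))" using sum_le_suminf[of "\<lambda>i. v k (i, y)" "{i}"] by simp
        moreover from this False have "ennreal m * (\<Sum>i. v k (i, y)) \<le> F (\<Sum>i. v k (i, y))"
          by (intro R) auto
        ultimately have "ennreal m * v k (i, y) \<le> F (\<Sum>i. v k (i, y))"
          by (meson mult_left_mono order_trans zero_le)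
        then have "v k (i, y) * ennreal m / ennreal m \<le> q 0 (v k) y / ennreal m"
          unfolding q_def by (intro divide_right_mono_ennreal) (simp add: mult.commute)
        then show ?thesis using m by (simp add: ennreal_mult_divide_eq add_increasing)
      qed simp
      have "D k 0 \<le> ennreal B" unfolding D_def using K(3) by (auto intro!: SUP_least)
      then have q0: "(\<integral>\<^sup>+y. q 0 (v k) y \<partial>?L) \<le> ennreal B"
        using v[of k] by (auto simp: C_def intro: order_trans)
      have "(INF j\<in>{k..}. a j i) \<le> (\<integral>\<^sup>+y. v k (i, y) \<partial>?L)" using v[of k] by (auto simp: C_def)
      also have "\<dots> \<le> (\<integral>\<^sup>+y. min (v k (i, y)) (ennreal R) + q 0 (v k) y / ennreal m \<partial>?L)"
        by (intro nn_integral_mono ptw)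
      also have "\<dots> = (\<integral>\<^sup>+y. min (v k (i, y)) (ennreal R) \<partial>?L) + (\<integral>\<^sup>+y. q 0 (v k) y \<partial>?L) / ennreal m"
        by (subst nn_integral_add) (auto simp: nn_integral_divide)
      also have "\<dots> \<le> (\<integral>\<^sup>+y. min (v k (i, y)) (ennreal R) \<partial>?L) + ennreal B / ennreal m"
        by (intro add_left_mono divide_right_mono_ennreal q0)
      also have "\<dots> \<le> (\<integral>\<^sup>+y. min (v k (i, y)) (ennreal R) \<partial>?L) + ennreal \<epsilon>"
        using m K(4) by (intro add_left_mono) (auto simp: divide_ennreal intro!: ennreal_leI)
      finally show ?thesis .
    qed
    moreover have "(\<lambda>k. INF j\<in>{k..}. a j i) \<longlonglongrightarrow> al i" by (rule tendsto_tail_INF[OF a(3)])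
    moreover have "(\<lambda>k. (\<integral>\<^sup>+y. min (v k (i, y)) (ennreal R) \<partial>?L) + ennreal \<epsilon>)
        \<longlonglongrightarrow> (\<integral>\<^sup>+y. min (V i y) (ennreal R) \<partial>?L) + ennreal \<epsilon>"
    proof (intro tendsto_add tendsto_const nn_integral_dominated_convergence[where w="\<lambda>_. ennreal R"])
      show "(\<integral>\<^sup>+y. ennreal R \<partial>?L) < \<infinity>"
      proof -
        have "emeasure ?L \<Omega> < top" by (metis L.emeasure_finite infinity_ennreal_def less_top)
        then show ?thesis by (simp add: ennreal_mult_less_top)
      qed
      show "AE y in ?L. (\<lambda>k. min (v k (i, y)) (ennreal R)) \<longlonglongrightarrow> min (V i y) (ennreal R)"
        using conv by eventually_elim (auto intro!: tendsto_min)
    qed auto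
    ultimately have "al i \<le> (\<integral>\<^sup>+y. min (V i y) (ennreal R) \<partial>?L) + ennreal \<epsilon>"
      by (intro LIMSEQ_le) auto
    also have "\<dots> \<le> (\<integral>\<^sup>+y. V i y \<partial>?L) + ennreal \<epsilon>"
      by (intro add_right_mono nn_integral_mono) auto
    finally show "al i \<le> (\<integral>\<^sup>+y. V i y \<partial>?L) + ennreal \<epsilon>" .
  qed
  have partial: "(\<Sum>i<N. \<integral>\<^sup>+y. ennreal (c y (xl i)) * V i y \<partial>?L) + (\<integral>\<^sup>+y. F (\<Sum>i. V i y) \<partial>?L) \<le> Kl" for N
  proof -
    have "(\<Sum>i<N. \<integral>\<^sup>+y. ennreal (c y (xl i)) * V i y \<partial>?L) + (\<integral>\<^sup>+y. F (\<Sum>i. V i y) \<partial>?L)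
      = (\<integral>\<^sup>+y. (\<Sum>i<N. ennreal (c y (xl i)) * V i y) + F (\<Sum>i. V i y) \<partial>?L)"
      by (subst nn_integral_add) (auto simp: nn_integral_sum)
    also have "\<dots> \<le> (\<integral>\<^sup>+y. liminf (\<lambda>k. q N (v k) y) \<partial>?L)"
    proof (intro nn_integral_mono_AE)
      show "AE y in ?L. (\<Sum>i<N. ennreal (c y (xl i)) * V i y) + F (\<Sum>i. V i y) \<le> liminf (\<lambda>k. q N (v k) y)"
        using conv
      proof eventually_elim
        case (elim y)
        have "(\<lambda>k. \<Sum>i<N. ennreal (c y (xl i)) * v k (i, y)) \<longlonglongrightarrow> (\<Sum>i<N. ennreal (c y (xl i)) * V i y)"
          using elim by (intro tendsto_sum ennreal_tendsto_cmult) auto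
        then have t1: "(\<Sum>i<N. ennreal (c y (xl i)) * V i y) = liminf (\<lambda>k. \<Sum>i<N. ennreal (c y (xl i)) * v k (i, y))"
          by (intro lim_imp_Liminf[symmetric]) auto
        \<comment> \<open>Convergence of each term does not give convergence of the series; Fatou's
          inequality suffices since \<open>F_lsc\<close> only asks for a lower limit.\<close>
        have t2: "F (\<Sum>i. V i y) \<le> liminf (\<lambda>k. F (\<Sum>i. v k (i, y)))"
          unfolding V_def by (intro F_lsc suminf_liminf_le)
        show ?case
          unfolding q_def by (rule order_trans[OF add_mono[OF eq_refl[OF t1] t2] liminf_add_le_ennreal])
      qed
    qed
    also have "\<dots> \<le> liminf (\<lambda>k. \<integral>\<^sup>+y. q N (v k) y \<partial>?L)" by (intro nn_integral_liminf) measurable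
    also have "\<dots> \<le> liminf (\<lambda>k. D k N)"
      using v by (intro Liminf_mono always_eventually) (auto simp: C_def)
    \<comment> \<open>N is fixed while k grows, so only finitely many errors have to vanish.\<close>
    also have "\<dots> = Kl + (\<Sum>i<N. 0)"
      unfolding D_def by (intro lim_imp_Liminf tendsto_tail_SUP tendsto_add tendsto_sum K(2) e) auto
    finally show ?thesis by simp
  qed
  have "(\<integral>\<^sup>+y. (\<Sum>i. ennreal (c y (xl i)) * V i y) + F (\<Sum>i. V i y) \<partial>?L)
    = (\<Sum>i. \<integral>\<^sup>+y. ennreal (c y (xl i)) * V i y \<partial>?L) + (\<integral>\<^sup>+y. F (\<Sum>i. V i y) \<partial>?L)"
    by (subst nn_integral_add) (auto simp: nn_integral_suminf)
  also have "\<dots> \<le> Kl"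
  proof (rule LIMSEQ_le_const2)
    show "(\<lambda>N. (\<Sum>i<N. \<integral>\<^sup>+y. ennreal (c y (xl i)) * V i y \<partial>?L) + (\<integral>\<^sup>+y. F (\<Sum>i. V i y) \<partial>?L))
      \<longlonglongrightarrow> (\<Sum>i. \<integral>\<^sup>+y. ennreal (c y (xl i)) * V i y \<partial>?L) + (\<integral>\<^sup>+y. F (\<Sum>i. V i y) \<partial>?L)"
      by (intro tendsto_add summable_LIMSEQ) auto
  qed (use partial in auto)
  finally show thesis using that[of V] Vm mass_le mass_ge by (auto intro: antisym)
qed

section \<open>From minimising sequences to minimisers\<close>

text \<open>Transport cost and \<open>Ffun\<close> are separate infima, so a coupling and a density
  are chosen independently, each within \<epsilon>/2. An infinite infimum, as over an empty set,
  makes the claim trivial.\<close>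

lemma le_Inf_add_Inf_add:
  fixes m r :: ennreal
  assumes "\<And>s t. s \<in> S \<Longrightarrow> t \<in> T \<Longrightarrow> m \<le> s + t + r"
  shows "m \<le> Inf S + Inf T + r"
proof (rule ennreal_le_epsilon)
  fix \<epsilon> :: real assume fin: "Inf S + Inf T + r < top" and \<epsilon>: "0 < \<epsilon>"
  have less: "i < i + ennreal (\<epsilon> / 2)" if "i < top" for i
    using that \<epsilon> by (cases i) (auto simp: ennreal_less_iff simp flip: ennreal_plus)
  have "Inf S \<le> Inf S + Inf T + r" "Inf T \<le> Inf S + Inf T + r"
    by (auto simp: add_increasing add_increasing2)
  from this[THEN le_less_trans, OF fin, THEN less]
  have "Inf S < Inf S + ennreal (\<epsilon> / 2)" "Inf T < Inf T + ennreal (\<epsilon> / 2)" .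
  then obtain s t where st: "s \<in> S" "s < Inf S + ennreal (\<epsilon> / 2)" "t \<in> T" "t < Inf T + ennreal (\<epsilon> / 2)"
    unfolding Inf_less_iff by blast
  have "m \<le> s + t + r" using st by (intro assms)
  also have "\<dots> \<le> (Inf S + ennreal (\<epsilon> / 2)) + (Inf T + ennreal (\<epsilon> / 2)) + r"
    using st by (intro add_mono) auto
  also have "\<dots> = Inf S + Inf T + r + (ennreal (\<epsilon> / 2) + ennreal (\<epsilon> / 2))" by (simp add: ac_simps)
  also have "ennreal (\<epsilon> / 2) + ennreal (\<epsilon> / 2) = ennreal \<epsilon>" using \<epsilon> by (simp flip: ennreal_plus)
  finally show "m \<le> Inf S + Inf T + r + ennreal \<epsilon>" .
qed

text \<open>The two parts of the energy pass to the limit differently: the integral part through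
  averaged densities, the \<open>g\<close> part through the convergent masses, which the new
  densities are built to reproduce.\<close>

lemma reduced_minimising_sequence_limit:
  fixes \<Omega> :: "'a::euclidean_space set" and c :: "'a \<Rightarrow> 'a \<Rightarrow> real" and m :: real
  assumes \<Omega>: "compact \<Omega>"
    and c: "continuous_on (\<Omega> \<times> \<Omega>) (\<lambda>(y, z). c y z)" "\<And>y z. 0 \<le> c y z"
    and F: "mono F" "\<And>s t. F ((s + t) / 2) \<le> (F s + F t) / 2"
      "\<And>X t. t \<le> liminf X \<Longrightarrow> F t \<le> liminf (\<lambda>k::nat. F (X k))"
      "\<And>M::real. \<exists>R::real. \<forall>t. ennreal R \<le> t \<longrightarrow> ennreal M * t \<le> F t"
    and g: "lsc_on {0..1} g" "((\<lambda>t. g t / ennreal t) \<longlongrightarrow> \<infinity>) (at_right 0)"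
    and adm: "\<And>k. admissible \<Omega> (x k) (U k)"
    and small: "\<And>k i. (\<integral>\<^sup>+y. U k i y \<partial>lebesgue_within \<Omega>) \<le> ennreal (1 / real (Suc i))"
    and m: "0 \<le> m" "\<And>k. reduced_energy c F g \<Omega> (x k) (U k) \<le> ennreal (m + 1 / real (Suc k))"
  obtains xl V where "admissible \<Omega> xl V" "reduced_energy c F g \<Omega> xl V \<le> ennreal m"
proof -
  let ?L = "lebesgue_within \<Omega>"
  have x: "x k i \<in> \<Omega>" for k i using adm[of k] by (auto simp: admissible_def)
  define a where "a k i = enn2real (\<integral>\<^sup>+y. U k i y \<partial>?L)" for k i
  have a: "(\<integral>\<^sup>+y. U k i y \<partial>?L) = ennreal (a k i)" for k i
    unfolding a_def by (rule ennreal_enn2real_admissible[OF adm, symmetric])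
  have a0: "0 \<le> a k i" for k i by (simp add: a_def)
  have a1: "a k i \<le> 1 / real (Suc i)" for k i
    using small[of k i] unfolding a by (subst (asm) ennreal_le_iff) auto
  have a1': "a k i \<le> 1" for k i
    by (rule order_trans[OF a1]) (simp add: field_simps)
  define K where "K k = (\<integral>\<^sup>+y. (\<Sum>i. ennreal (c y (x k i)) * U k i y) + F (\<Sum>i. U k i y) \<partial>?L)" for k
  define G where "G k = (\<Sum>i. g (a k i))" for k
  have KG: "K k + G k \<le> ennreal (m + 1 / real (Suc k))" for k
    using m(2)[of k] unfolding reduced_energy_def K_def G_def a_def .
  have KGB: "K k + G k \<le> ennreal (m + 1)" for k
    by (rule order_trans[OF KG ennreal_leI]) (simp add: field_simps)
  have KB: "K k \<le> ennreal (m + 1)" and GB: "G k \<le> ennreal (m + 1)" for k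
    using KGB[of k] by (meson add_increasing add_increasing2 order_refl order_trans zero_le)+
  obtain l r where r: "strict_mono r" and l: "\<And>i. l i \<in> \<Omega> \<times> {0..1}"
    "\<And>i. (\<lambda>k. (x (r k) i, a (r k) i)) \<longlonglongrightarrow> l i"
  proof (rule diagonal_convergent_subsequence[of "\<lambda>_. \<Omega> \<times> {0..1}" "\<lambda>k i. (x k i, a k i)"])
    show "compact (\<Omega> \<times> {0..1::real})" using \<Omega> by (intro compact_Times) auto
    show "(x k i, a k i) \<in> \<Omega> \<times> {0..1}" for k i
      using x a0 a1' by auto
  qed (rule that)
  \<comment> \<open>A further subsequence, by compactness of [0, \<infinity>], gives the integral
    part its own limit; only the sum of the two parts is known to approach the infimum.\<close>
  obtain Kl r' where r': "strict_mono r'" "(\<lambda>k. K (r (r' k))) \<longlonglongrightarrow> Kl"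
    using compact_complete_linorder[of "K \<circ> r"] by (auto simp: comp_def)
  define s where "s = r \<circ> r'"
  have s: "strict_mono s" unfolding s_def using r r'(1) by (rule strict_mono_o)
  define xl where "xl i = fst (l i)" for i
  define al where "al i = snd (l i)" for i
  have lim: "(\<lambda>k. (x (s k) i, a (s k) i)) \<longlonglongrightarrow> (xl i, al i)" for i
    using LIMSEQ_subseq_LIMSEQ[OF l(2) r'(1)] by (simp add: s_def comp_def xl_def al_def)
  have xlim: "(\<lambda>k. x (s k) i) \<longlonglongrightarrow> xl i" for i using tendsto_fst[OF lim] by simp
  have alim: "(\<lambda>k. a (s k) i) \<longlonglongrightarrow> al i" for i using tendsto_snd[OF lim] by simp
  have xl: "xl i \<in> \<Omega>" and al: "al i \<in> {0..1}" for i using l(1)[of i] by (auto simp: xl_def al_def mem_Times_iff)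
  have Klim: "(\<lambda>k. K (s k)) \<longlonglongrightarrow> Kl" using r'(2) by (simp add: s_def)
  obtain V where V: "\<And>i. V i \<in> borel_measurable ?L" "\<And>i. (\<integral>\<^sup>+y. V i y \<partial>?L) = ennreal (al i)"
    "(\<integral>\<^sup>+y. (\<Sum>i. ennreal (c y (xl i)) * V i y) + F (\<Sum>i. V i y) \<partial>?L) \<le> Kl"
  proof (rule reduced_lower_semicontinuity[OF \<Omega> c F, where x="\<lambda>k. x (s k)" and xl=xl and U="\<lambda>k. U (s k)"
        and a="\<lambda>k i. ennreal (a (s k) i)" and al="\<lambda>i. ennreal (al i)" and K="\<lambda>k. K (s k)" and Kl=Kl and B="m + 1"])
    show "\<And>k i. U (s k) i \<in> borel_measurable ?L"
      using adm by (auto simp: admissible_def)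
    show "\<And>k. (\<integral>\<^sup>+y. (\<Sum>i. ennreal (c y (x (s k) i)) * U (s k) i y) + F (\<Sum>i. U (s k) i y) \<partial>?L) = K (s k)"
      by (simp add: K_def)
    show "\<And>k i. ennreal (a (s k) i) \<le> 1" using a1' by simp
    show "\<And>i. (\<lambda>k. ennreal (a (s k) i)) \<longlonglongrightarrow> ennreal (al i)" by (intro tendsto_ennrealI alim)
  qed (use x xl xlim Klim KB m(1) a that in auto)
  have "(\<Sum>i. ennreal (al i)) = 1"
  proof (rule atomic_masses_conserved[OF _ _ _ alim g(2)])
    show "(\<Sum>i. ennreal (a (s k) i)) = 1" for k
      using adm[of "s k"] by (simp add: admissible_def a)
    show "(\<Sum>i. g (a (s k) i)) \<le> ennreal (m + 1)" for k using GB by (simp add: G_def)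
  qed (use a0 a1 m(1) in auto)
  then have "admissible \<Omega> xl V" using xl V by (auto simp: admissible_def)
  moreover have "reduced_energy c F g \<Omega> xl V \<le> ennreal m"
  proof -
    have "(\<Sum>i. g (enn2real (\<integral>\<^sup>+y. V i y \<partial>?L))) = (\<Sum>i. g (al i))" using al by (simp add: V(2))
    also have "\<dots> \<le> (\<Sum>i. liminf (\<lambda>k. g (a (s k) i)))"
      using al a0 a1' by (intro suminf_le lsc_on_sequentially[OF g(1)] alim) auto
    also have "\<dots> \<le> liminf (\<lambda>k. G (s k))" unfolding G_def by (rule suminf_liminf_le)
    finally have "reduced_energy c F g \<Omega> xl V \<le> Kl + liminf (\<lambda>k. G (s k))"
      unfolding reduced_energy_def by (intro add_mono V(3))
    also have "Kl = liminf (\<lambda>k. K (s k))" using Klim by (intro lim_imp_Liminf[symmetric]) auto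
    also have "liminf (\<lambda>k. K (s k)) + liminf (\<lambda>k. G (s k)) \<le> liminf (\<lambda>k. K (s k) + G (s k))"
      by (rule liminf_add_le_ennreal)
    also have "\<dots> \<le> liminf (\<lambda>k. ennreal (m + 1 / real (Suc (s k))))"
      by (intro Liminf_mono always_eventually allI KG)
    also have "\<dots> = ennreal (m + 0)"
    proof (intro lim_imp_Liminf tendsto_ennrealI tendsto_add tendsto_const)
      show "(\<lambda>k. 1 / real (Suc (s k))) \<longlonglongrightarrow> 0"
        using LIMSEQ_subseq_LIMSEQ[OF LIMSEQ_Suc[OF lim_1_over_n] s] by (simp add: comp_def)
    qed auto
    finally show ?thesis by simp
  qed
  ultimately show thesis using that by blast
qed

theorem theorem2p1:
  fixes \<Omega> :: "'a::euclidean_space set" and p :: real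
    and f :: "ennreal \<Rightarrow> ennreal" and g :: "real \<Rightarrow> ennreal"
  assumes "compact \<Omega>" and "\<Omega> \<noteq> {}" and "p \<ge> 1"
    and "lsc_ennreal f" and "convex_ennreal f" and "f 0 = 0"
    and "((\<lambda>t::real. f (ennreal t) / ennreal t) \<longlongrightarrow> \<infinity>) at_top"
    and "subadditive_on01 g" and "lsc_on {0..1} g" and "g 0 = 0"
    and "((\<lambda>t. g t / ennreal t) \<longlongrightarrow> \<infinity>) (at_right 0)"
  shows "\<exists>\<mu>\<in>probs \<Omega>. \<exists>\<nu>\<in>probs \<Omega>. \<forall>\<mu>'\<in>probs \<Omega>. \<forall>\<nu>'\<in>probs \<Omega>.
           total_energy p f g \<Omega> \<mu> \<nu> \<le> total_energy p f g \<Omega> \<mu>' \<nu>'"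
proof -
  let ?L = "lebesgue_within \<Omega>"
  let ?c = "\<lambda>y z :: 'a. norm (y - z) powr p"
  let ?E = "reduced_energy ?c (fix_top f) g \<Omega>"
  have F: "mono (fix_top f)" using assms by (intro mono_fix_top)
  have Fm: "fix_top f \<in> borel_measurable borel" by (rule borel_measurable_mono_ennreal[OF F])
  \<comment> \<open>The bound 1/(i+1) is all that is retained of the decreasing order. The original
    energy is bounded below by this restricted infimum, since \<open>coupling_reducible\<close>
    supplies data obeying it.\<close>
  define adm where "adm = {(x, U). admissible \<Omega> x U \<and>
    (\<forall>i. (\<integral>\<^sup>+y. U i y \<partial>?L) \<le> ennreal (1 / real (Suc i)))}"
  define m where "m = (INF (x, U)\<in>adm. ?E x U)"
  have lower: "m \<le> total_energy p f g \<Omega> \<mu> \<nu>" if \<mu>: "\<mu> \<in> probs \<Omega>" and \<nu>: "\<nu> \<in> probs \<Omega>" for \<mu> \<nu>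
  proof (cases "purely_atomic \<nu>")
    case True
    show ?thesis
      unfolding total_energy_def transport_cost_def Ffun_def
    proof (rule le_Inf_add_Inf_add)
      fix s t
      assume "s \<in> (\<lambda>\<gamma>. \<integral>\<^sup>+z. ennreal (norm (fst z - snd z) powr p) \<partial>\<gamma>) ` couplings \<Omega> \<mu> \<nu>"
        and "t \<in> {\<integral>\<^sup>+x. f (u x) \<partial>?L | u. u \<in> borel_measurable ?L \<and> \<mu> = density ?L u}"
      then obtain \<gamma> u where \<gamma>: "\<gamma> \<in> couplings \<Omega> \<mu> \<nu>" "s = (\<integral>\<^sup>+z. ennreal (norm (fst z - snd z) powr p) \<partial>\<gamma>)"
        and u: "u \<in> borel_measurable ?L" "\<mu> = density ?L u" "t = (\<integral>\<^sup>+x. f (u x) \<partial>?L)"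
        by blast
      obtain x U where "admissible \<Omega> x U" "\<And>i. (\<integral>\<^sup>+y. U i y \<partial>?L) \<le> ennreal (1 / real (Suc i))"
        and E: "?E x U \<le> s + t + Gfun g \<nu>"
        using coupling_reducible[where g=g and f=f and p=p, OF assms(1,2) \<mu> \<nu> \<gamma>(1) u(1,2) True assms(10) Fm]
        unfolding \<gamma>(2) u(3) by blast
      then have "(x, U) \<in> adm" by (auto simp: adm_def)
      then have "m \<le> ?E x U" unfolding m_def by (intro INF_lower2[of "(x, U)"]) auto
      with E show "m \<le> s + t + Gfun g \<nu>" by (rule order_trans[rotated])
    qed
  qed (simp add: total_energy_def Gfun_def)
  show ?thesis
  proof (cases "m = \<infinity>")
    case True
    \<comment> \<open>Every pair has infinite energy here, so any pair minimises; a Dirac measure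
      shows that one exists.\<close>
    obtain z where "z \<in> \<Omega>" using assms(2) by blast
    then have "return (restrict_space borel \<Omega>) z \<in> probs \<Omega>"
      by (auto simp: probs_def space_restrict_space intro!: prob_space_return)
    moreover have "total_energy p f g \<Omega> \<mu> \<nu> = \<infinity>" if "\<mu> \<in> probs \<Omega>" "\<nu> \<in> probs \<Omega>" for \<mu> \<nu>
      using lower[OF that] True by (simp add: top_unique)
    ultimately show ?thesis by (metis order_refl)
  next
    case False
    then obtain m' where m': "m = ennreal m'" "0 \<le> m'" by (cases m) auto
    have "\<exists>x U. (x, U) \<in> adm \<and> ?E x U \<le> ennreal (m' + 1 / real (Suc k))" for k
    proof -
      have "m < ennreal (m' + 1 / real (Suc k))" unfolding m'(1) using m'(2) by (intro ennreal_lessI add_nonneg_pos) auto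
      then show ?thesis unfolding m_def INF_less_iff by (auto intro: less_imp_le)
    qed
    then obtain x U where xU: "\<And>k. (x k, U k) \<in> adm" "\<And>k. ?E (x k) (U k) \<le> ennreal (m' + 1 / real (Suc k))"
      by metis
    obtain xl V where V: "admissible \<Omega> xl V" "?E xl V \<le> ennreal m'"
    proof (rule reduced_minimising_sequence_limit[OF assms(1) _ _ F, where c="?c" and g=g and x=x and U=U and m=m'])
      \<comment> \<open>Continuity on the diagonal, where the base vanishes, comes from the positive
        exponent.\<close>
      show "continuous_on (\<Omega> \<times> \<Omega>) (\<lambda>(y, z). norm (y - z) powr p)"
        unfolding case_prod_unfold using assms(3) by (intro continuous_on_powr' continuous_intros) auto
      show "fix_top f ((s + t) / 2) \<le> (fix_top f s + fix_top f t) / 2" for s t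
        by (rule fix_top_midpoint[OF assms(5)])
      show "fix_top f t \<le> liminf (\<lambda>k. fix_top f (X k))" if "t \<le> liminf X" for X :: "nat \<Rightarrow> ennreal" and t
        by (rule fix_top_le_liminf[OF assms(5,6,4,7) that])
      show "\<exists>R::real. \<forall>t. ennreal R \<le> t \<longrightarrow> ennreal M * t \<le> fix_top f t" for M
        by (rule fix_top_superlinear[OF assms(7), of M]) blast
    qed (use assms xU m'(2) that in \<open>auto simp: adm_def\<close>)
    obtain \<mu> \<nu> where \<mu>\<nu>: "\<mu> \<in> probs \<Omega>" "\<nu> \<in> probs \<Omega>" "total_energy p f g \<Omega> \<mu> \<nu> \<le> ?E xl V"
      using reduced_energy_realisable[OF assms(1) V(1) Fm fix_top_ge assms(8-10)] by blast
    have "total_energy p f g \<Omega> \<mu> \<nu> \<le> total_energy p f g \<Omega> \<mu>' \<nu>'" if "\<mu>' \<in> probs \<Omega>" "\<nu>' \<in> probs \<Omega>" for \<mu>' \<nu>'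
      using order_trans[OF \<mu>\<nu>(3) V(2)] lower[OF that] m'(1) by (auto intro: order_trans)
    with \<mu>\<nu>(1,2) show ?thesis by blast
  qed
qed

end
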